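(* Let $\mathcal{M}$ be a pure motive over $\mathbb{Q}$ of odd motivic weight $w=2m+1\geq 3$, even rank $d\geq 2$, global conductor $N$, and Hodge numbers $h_\nu$ ($0\leq \nu\leq m$). Suppose that the $L$-function $L(s,\mathcal{M})$ coincides with the $L$-function of an algebraic, tempered, cuspidal symplectic representation of $\mathrm{GL}_d(\mathbb{A}_{\mathbb{Q}})$, and let $p_{\mathcal{M}}(z)$ be the polynomial defined in the context below. \begin{enumerate} \item If $m=1$ and $h_0\in\{0,1\}$, then all zeros of $p_{\mathcal{M}}(z)$ lie on the unit circle $\mathbb{S}^1=\{z\in\mathbb{C}:|z|=1\}$ and tend to be equidistributed on $\mathbb{S}^1$ as $N\to\infty$. \item If $m\geq 2$, $2m^{h_m}\geq (1+1/m)^{h_0}$, and $N>A_m^d$, where \[A_m:=\max_{1\leq j\leq m-1}\frac{2\pi}{m-j}\Big(\frac{\zeta(j+1/2)}{\zeta(j+3/2)}\Big)^2\] ($\zeta$ the Riemann zeta function), then all zeros of $p_{\mathcal{M}}(z)$ lie on $\mathbb{S}^1$ and tend to be equidistributed on $\mathbb{S}^1$ as $N\to\infty$. \end{enumerate}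
   Context: Setting: $\mathcal{M}$ is a pure motive over $\mathbb{Q}$ of weight $w=2m+1$, rank $d$, global conductor $N$, with Hodge decomposition $H_B(\mathcal{M})\otimes\mathbb{C}=\bigoplus_{i+j=w}H^{i,j}(\mathcal{M})$ and Hodge numbers $h_\nu=\dim_{\mathbb{C}}H^{\nu,w-\nu}(\mathcal{M})$ for $0\leq\nu\leq m$; since $w$ is odd, $d=2\sum_{\nu=0}^m h_\nu$. The $L$-function is $L(s,\mathcal{M})=\prod_p L_p(p^{-s},\mathcal{M})=\sum_{n\ge1}\lambda_{\mathcal{M}}(n)n^{-s}$ (absolutely convergent for $\Re(s)>w/2+1$), where $L_p(X,\mathcal{M})=\det(1-X\rho_\ell(\mathrm{Frob}_p^{-1})|_{H_\ell(\mathcal{M})^{I_p}})^{-1}$. Put $\Gamma_{\mathbb{C}}(s)=2(2\pi)^{-s}\Gamma(s)$, $L_\infty(s,\mathcal{M})=\prod_{\nu=0}^{m}\Gamma_{\mathbb{C}}(s-\nu)^{h_\nu}$, and $\Lambda(s,\mathcal{M})=N^{s/2}L_\infty(s,\mathcal{M})L(s,\mathcal{M})$. Under the automorphy assumption (algebraic, self-dual, tempered, cuspidal, symplectic, i.e. the exterior square $L$-function has a pole), the following hold: $\lambda_{\mathcal{M}}(n)\in\mathbb{R}$; $|\lambda_{\mathcal{M}}(n)|\le d(n)n^{w/2}$ with $d(n)$ the divisor function; $\Lambda(s,\mathcal{M})$ is entire of order $1$; $\Lambda(s,\mathcal{M})=\varepsilon\Lambda(w+1-s,\mathcal{M})$ for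 a root number $\varepsilon\in\{\pm1\}$; and $\Lambda(\frac{w+1}{2},\mathcal{M})\geq 0$. The polynomial is \[p_{\mathcal{M}}(z):=\sum_{j=0}^{2m}\Big[\prod_{\nu=0}^m\binom{2m-\nu}{m-|m-j|}^{h_\nu}\Big]\Lambda(2m+1-j,\mathcal{M})\,z^j.\] *)

theory Defs
  imports
    "HOL-Complex_Analysis.Complex_Analysis"
    "HOL-Computational_Algebra.Computational_Algebra"
    "HOL-Library.Landau_Symbols"
begin

text \<open>
  Neither the category of pure motives nor automorphic representations of
  $GL_d$ over the adeles are available. A motive is represented by the numerical and
  analytic data that enter its $L$-function; what purity and automorphy say about these data
  is collected in \<open>automorphic_motive\<close> below.

  \<^item> \<open>half_wt\<close> is $m$, where the weight is $w = 2m+1$;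
  \<^item> \<open>hodge\<close> $\nu$ is $h_\nu = \dim H^{\nu,w-\nu}$, relevant for $0 \le \nu \le m$ only;
  \<^item> \<open>frob_poly\<close> $p$ is $\det(1 - X \rho_\ell(Frob_p^{-1}) | H_\ell^{I_p})$, so that the local
    factor is $L_p(X) = 1 / $ \<open>frob_poly\<close> $p$;
  \<^item> \<open>dcoeff\<close> is the sequence of Dirichlet coefficients $\lambda(n)$;
  \<^item> \<open>completed_L\<close> is the analytic continuation of $\Lambda(s)$ to the whole plane.
\<close>

record motive =
  half_wt :: nat
  rank :: nat
  conductor :: nat
  hodge :: "nat \<Rightarrow> nat"
  frob_poly :: "nat \<Rightarrow> complex poly"
  dcoeff :: "nat \<Rightarrow> complex"
  completed_L :: "complex \<Rightarrow> complex"

definition weight :: "motive \<Rightarrow> nat" where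
  "weight M = 2 * half_wt M + 1"

text \<open>Only meaningful for $\Re(s) > w/2 + 1$, where the product converges.\<close>

definition motive_L :: "motive \<Rightarrow> complex \<Rightarrow> complex" where
  "motive_L M s =
     prodinf (\<lambda>p. if prime p then 1 / poly (frob_poly M p) (of_nat p powr (- s)) else 1)"

definition Gamma_C :: "complex \<Rightarrow> complex" where
  "Gamma_C s = 2 * of_real (2 * pi) powr (- s) * Gamma s"

definition L_infty :: "motive \<Rightarrow> complex \<Rightarrow> complex" where
  "L_infty M s = (\<Prod>\<nu>=0..half_wt M. Gamma_C (s - of_nat \<nu>) ^ hodge M \<nu>)"

text \<open>The order of growth of an entire function.\<close>

definition growth_order :: "(complex \<Rightarrow> complex) \<Rightarrow> ereal" where
  "growth_order f =
     Inf (ereal ` {a. 0 \<le> a \<and> (\<lambda>z. norm (f z)) \<in> O[at_infinity](\<lambda>z. exp (norm z powr a))})"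

text \<open>
  The $r$-fold divisor function: the number of ordered factorisations of $n$ into $r$ factors.
  For $r = 2$ this is the usual divisor function.
\<close>

definition divisor_fun :: "nat \<Rightarrow> nat \<Rightarrow> nat" where
  "divisor_fun r n = card {xs :: nat list. length xs = r \<and> prod_list xs = n}"

text \<open>
  The roots of \<open>frob_poly\<close> $p$ are the inverses of the Frobenius eigenvalues, so purity of
  weight $w$ and temperedness say that they have absolute value $p^{-w/2}$ at the good primes and
  at least $p^{-w/2}$ at the primes dividing the conductor. This forces
  $|\lambda(n)| \le d_r(n) n^{w/2}$ with the divisor function of order the rank $r$.
\<close>

definition automorphic_motive :: "motive \<Rightarrow> bool" where
  "automorphic_motive M \<longleftrightarrow>
     rank M \<ge> 2 \<and>
     rank M = 2 * (\<Sum>\<nu>=0..half_wt M. hodge M \<nu>) \<and>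
     conductor M \<ge> 1 \<and>
     (\<forall>p. prime p \<longrightarrow>
        coeff (frob_poly M p) 0 = 1 \<and>
        degree (frob_poly M p) \<le> rank M \<and>
        (\<forall>x. poly (frob_poly M p) x = 0 \<longrightarrow> norm x \<ge> real p powr (- (real (weight M) / 2))) \<and>
        (\<not> p dvd conductor M \<longrightarrow>
           degree (frob_poly M p) = rank M \<and>
           (\<forall>x. poly (frob_poly M p) x = 0 \<longrightarrow> norm x = real p powr (- (real (weight M) / 2))))) \<and>
     (\<forall>s. Re s > real (weight M) / 2 + 1 \<longrightarrow>
        summable (\<lambda>n. norm (dcoeff M (Suc n) * of_nat (Suc n) powr (- s))) \<and>
        (\<lambda>n. dcoeff M (Suc n) * of_nat (Suc n) powr (- s)) sums motive_L M s) \<and>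
     (\<forall>n\<ge>1. dcoeff M n \<in> \<real> \<and>
        norm (dcoeff M n) \<le> real (divisor_fun (rank M) n) * real n powr (real (weight M) / 2)) \<and>
     completed_L M holomorphic_on UNIV \<and>
     growth_order (completed_L M) = 1 \<and>
     (\<forall>s. Re s > real (weight M) / 2 + 1 \<longrightarrow>
        completed_L M s = of_nat (conductor M) powr (s / 2) * L_infty M s * motive_L M s) \<and>
     (\<exists>\<epsilon>\<in>{1, -1}. \<forall>s. completed_L M s = \<epsilon> * completed_L M (of_nat (weight M) + 1 - s)) \<and>
     completed_L M ((of_nat (weight M) + 1) / 2) \<in> \<real>\<^sub>\<ge>\<^sub>0"

definition period_poly :: "motive \<Rightarrow> complex poly" where
  "period_poly M = (let m = half_wt M in
     \<Sum>j=0..2*m. monom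
       ((\<Prod>\<nu>=0..m. of_nat ((2 * m - \<nu>) choose nat (int m - \<bar>int m - int j\<bar>)) ^ hodge M \<nu>)
          * completed_L M (of_nat (2 * m + 1 - j))) j)"

text \<open>The Riemann zeta function at real arguments $x > 1$.\<close>

definition zeta_real :: "real \<Rightarrow> real" where
  "zeta_real x = (\<Sum>n. 1 / real (Suc n) powr x)"

definition A_const :: "nat \<Rightarrow> real" where
  "A_const m = Max ((\<lambda>j. 2 * pi / (real m - real j) *
     (zeta_real (real j + 1/2) / zeta_real (real j + 3/2))\<^sup>2) ` {1..m-1})"

definition zeros_on_unit_circle :: "complex poly \<Rightarrow> bool" where
  "zeros_on_unit_circle P \<longleftrightarrow> (\<forall>z. poly P z = 0 \<longrightarrow> norm z = 1)"

text \<open>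
  The zeros (counted with multiplicity) of a sequence of polynomials of fixed degree $n$ tend to
  be equidistributed on the unit circle: the $n$ zeros of the $k$-th polynomial can be listed as
  $e^{i \theta_{k,l}}$, $l < n$, such that up to a rotation by $\varphi_k$ the angles
  $\theta_{k,l}$ approach the equally spaced angles $2 \pi l / n$. As the number of zeros stays
  fixed, this (and not weak convergence to the uniform measure) is the meaning of the phrase.
\<close>

definition zeros_tend_to_equidistributed :: "nat \<Rightarrow> (nat \<Rightarrow> complex poly) \<Rightarrow> bool" where
  "zeros_tend_to_equidistributed n P \<longleftrightarrow>
     (\<exists>(\<theta> :: nat \<Rightarrow> nat \<Rightarrow> real) (\<phi> :: nat \<Rightarrow> real).
        (\<forall>k. P k \<noteq> 0 \<and>
             P k = smult (lead_coeff (P k)) (\<Prod>l<n. [:- cis (\<theta> k l), 1:])) \<and>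
        (\<forall>l<n. (\<lambda>k. \<theta> k l - (\<phi> k + 2 * pi * real l / real n)) \<longlonglongrightarrow> 0))"

end

theory Submission
  imports Defs "HOL-Real_Asymp.Real_Asymp"
begin

text \<open>
  By the functional equation, $p_M(z) = \sum_{j=0}^m a_j (z^{m-j} + \varepsilon z^{m+j})$, where
  $a_j$ is a binomial weight times $\Lambda(m+1+j)$ and $a_0$ carries an extra factor $1/2$. Put
  $q(z) = \sum_j a_j z^j$. If $0 \le a_0 \le \dots \le a_m$, then all zeros of $q$ lie in the closed
  unit disc, hence $|z^m q(1/z)| \le |q(z)| < |z^m q(z)|$ for $|z| > 1$, and $p_M$ has no zeros off the
  unit circle. If moreover $a_j / a_m \to 0$ for all $j < m$, then $p_M / a_m$ tends to
  $1 + \varepsilon z^{2m}$, whose zeros are equally spaced.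

  For $1 \le j < m$ the quotient $a_j / a_{j+1}$ equals
  $N^{-1/2} (2 \pi / (m-j))^{d/2} L(m+1+j) / L(m+2+j)$, and comparing Euler factors bounds it by
  $(A_m^d / N)^{1/2}$. For $j = 0$ one leaves the region of absolute convergence. There the inequality
  $\Lambda(m+1) \le \Lambda(m+1+x)$ for $x^2 \ge 1/2$ is a consequence of the Hadamard product: all zeros
  $m+1+\rho$ satisfy $|\Re \rho| \le 1/2$, hence $|1 - x^2/\rho^2| \ge 1$. Taking $x = 1$ gives
  $a_0 \le a_1$, while $x = 3/4$ gives $a_0 = O(N^{-1/8}) a_1$ when $m = 1$.
\<close>

section \<open>Self-inversive polynomials\<close>

lemma enestrom_kakeya:
  fixes a :: "nat \<Rightarrow> real" and z :: complex
  assumes mono: "\<And>i. i < m \<Longrightarrow> a i \<le> a (Suc i)" and "0 \<le> a 0" "0 < a m" "norm z > 1"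
  shows "(\<Sum>i\<le>m. of_real (a i) * z ^ i) \<noteq> 0"
proof
  assume zero: "(\<Sum>i\<le>m. of_real (a i) * z ^ i) = 0"
  have "(z - 1) * (\<Sum>i\<le>n. of_real (a i) * z ^ i) =
        of_real (a n) * z ^ Suc n - ((\<Sum>i<n. of_real (a (Suc i) - a i) * z ^ Suc i) + of_real (a 0))" for n
    by (induction n) (auto simp: algebra_simps)
  from this[of m] zero have eq:
    "of_real (a m) * z ^ Suc m = (\<Sum>i<m. of_real (a (Suc i) - a i) * z ^ Suc i) + of_real (a 0)"
    by simp
  have tele: "(\<Sum>i<m. a (Suc i) - a i) = a m - a 0"
    by (rule sum_lessThan_telescope)
  have "a m * norm z ^ Suc m = norm (of_real (a m) * z ^ Suc m)"
    using assms by (simp add: norm_mult norm_power)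
  also have "\<dots> \<le> (\<Sum>i<m. norm (of_real (a (Suc i) - a i) * z ^ Suc i)) + norm (of_real (a 0) :: complex)"
    unfolding eq by (intro order_trans[OF norm_triangle_ineq] add_mono norm_sum order_refl)
  also have "(\<Sum>i<m. norm (of_real (a (Suc i) - a i) * z ^ Suc i)) \<le> (\<Sum>i<m. (a (Suc i) - a i) * norm z ^ m)"
  proof (intro sum_mono)
    fix i assume i: "i \<in> {..<m}"
    have "norm z ^ Suc i \<le> norm z ^ m"
      using i assms by (intro power_increasing) auto
    moreover have "norm (of_real (a (Suc i) - a i) * z ^ Suc i) = (a (Suc i) - a i) * norm z ^ Suc i"
      unfolding norm_mult norm_power norm_of_real using mono[of i] i by simp
    ultimately show "norm (of_real (a (Suc i) - a i) * z ^ Suc i) \<le> (a (Suc i) - a i) * norm z ^ m"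
      using mono[of i] i by (simp only: mult_left_mono diff_ge_0_iff_ge lessThan_iff)
  qed
  also have "\<dots> = (a m - a 0) * norm z ^ m"
    by (simp only: tele sum_distrib_right [symmetric])
  also have "norm (of_real (a 0) :: complex) \<le> a 0 * norm z ^ m"
    using assms by (simp add: mult_le_cancel_left1)
  finally have "a m * norm z ^ Suc m \<le> a m * norm z ^ m"
    by (simp add: algebra_simps)
  hence "norm z ^ Suc m \<le> norm z ^ m" using assms by (simp only: mult_le_cancel_left_pos)
  moreover have "norm z ^ m < norm z ^ Suc m" using assms by (intro power_strict_increasing) auto
  ultimately show False by linarith
qed

lemma norm_reversed_sum_le:
  fixes a :: "nat \<Rightarrow> real" and z :: complex
  assumes roots: "\<And>w :: complex. norm w > 1 \<Longrightarrow> (\<Sum>i\<le>m. of_real (a i) * w ^ i) \<noteq> 0"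
    and am: "a m \<noteq> 0" and z: "norm z > 1"
  shows "norm (\<Sum>i\<le>m. of_real (a i) * z ^ (m - i)) \<le> norm (\<Sum>i\<le>m. of_real (a i) * z ^ i)"
proof -
  define p :: "complex poly" where "p = (\<Sum>i\<le>m. monom (of_real (a i)) i)"
  have poly_p: "poly p w = (\<Sum>i\<le>m. of_real (a i) * w ^ i)" for w
    by (simp add: p_def poly_sum poly_monom)
  have coeff_p: "coeff p i = (if i \<le> m then of_real (a i) else 0)" for i
    by (auto simp: p_def coeff_sum)
  have deg: "degree p = m"
    by (rule antisym[OF degree_le le_degree]) (auto simp: coeff_p am)
  obtain r :: "nat \<Rightarrow> complex" where "smult (lead_coeff p) (\<Prod>i<degree p. [:-r i, 1:]) = p"
    using complex_poly_decompose'[of p] by blast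
  hence "p = smult (of_real (a m)) (\<Prod>i<m. [:-r i, 1:])" by (simp add: deg coeff_p)
  hence r: "poly p w = of_real (a m) * (\<Prod>i<m. w - r i)" for w
    by (simp add: poly_prod)
  have r1: "norm (r i) \<le> 1" if "i < m" for i
  proof (rule ccontr)
    assume "\<not> norm (r i) \<le> 1"
    hence "poly p (r i) \<noteq> 0" using roots[of "r i"] by (simp add: poly_p)
    thus False using that by (auto simp: r)
  qed
  have z0: "z \<noteq> 0" using z by auto
  have "(\<Sum>i\<le>m. of_real (a i) * z ^ (m - i)) = z ^ m * poly p (1 / z)"
    unfolding poly_p sum_distrib_left using z0
    by (intro sum.cong) (auto simp: power_diff power_one_over field_simps)
  also have "\<dots> = of_real (a m) * (\<Prod>i<m. z * (1 / z - r i))"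
    by (simp add: r prod.distrib)
  also have "norm \<dots> \<le> norm (of_real (a m) :: complex) * (\<Prod>i<m. norm (cnj z - r i))"
    unfolding norm_mult prod_norm [symmetric]
  proof (intro mult_left_mono prod_mono conjI)
    fix i assume i: "i \<in> {..<m}"
    have "norm (z * (1 / z - r i)) = norm (1 - r i * z)"
      using z0 by (simp add: algebra_simps)
    also have "\<dots> \<le> norm (cnj z - r i)"
    proof (rule power2_le_imp_le)
      have "(norm (cnj z - r i))\<^sup>2 - (norm (1 - r i * z))\<^sup>2 = ((norm z)\<^sup>2 - 1) * (1 - (norm (r i))\<^sup>2)"
        unfolding cmod_power2 by (simp add: algebra_simps power2_eq_square)
      moreover have "\<dots> \<ge> 0"
        using z r1[of i] i by (intro mult_nonneg_nonneg) (auto simp: abs_square_le_1 power_le_one)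
      ultimately show "(norm (1 - r i * z))\<^sup>2 \<le> (norm (cnj z - r i))\<^sup>2" by linarith
    qed auto
    finally show "norm z * norm (1 / z - r i) \<le> norm (cnj z - r i)" by (simp add: norm_mult)
  qed auto
  also have "\<dots> = norm (poly p (cnj z))"
    by (simp add: r norm_mult prod_norm)
  also have "poly p (cnj z) = cnj (\<Sum>i\<le>m. of_real (a i) * z ^ i)"
    by (simp add: poly_p)
  finally show ?thesis by (simp only: complex_mod_cnj)
qed

locale self_inversive =
  fixes m :: nat and a :: "nat \<Rightarrow> real" and \<epsilon> :: complex and P :: "complex poly"
  assumes m: "m \<ge> 1"
    and mono: "\<And>i. i < m \<Longrightarrow> a i \<le> a (Suc i)"
    and a0: "0 \<le> a 0" and am: "0 < a m"
    and eps: "\<epsilon> \<in> {1, -1}"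
    and P: "P = (\<Sum>j\<le>m. monom (of_real (a j)) (m - j) + monom (\<epsilon> * of_real (a j)) (m + j))"
begin

lemma poly_P: "poly P z = (\<Sum>j\<le>m. of_real (a j) * (z ^ (m - j) + \<epsilon> * z ^ (m + j)))"
  by (simp add: P poly_sum poly_monom algebra_simps)

lemma zero_norm_le_1:
  assumes "poly P z = 0"
  shows "norm z \<le> 1"
proof (rule ccontr)
  assume "\<not> norm z \<le> 1"
  hence z: "norm z > 1" by simp
  define q where "q = (\<Sum>i\<le>m. of_real (a i) * z ^ i)"
  have q0: "q \<noteq> 0" unfolding q_def using mono a0 am z by (rule enestrom_kakeya)
  have "norm (\<Sum>i\<le>m. of_real (a i) * z ^ (m - i)) \<le> norm q"
    unfolding q_def
    by (rule norm_reversed_sum_le[OF enestrom_kakeya]) (use mono a0 am z in auto)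
  also have "poly P z = (\<Sum>i\<le>m. of_real (a i) * z ^ (m - i)) + \<epsilon> * z ^ m * q"
    by (simp add: poly_P q_def sum.distrib sum_distrib_left algebra_simps power_add)
  hence "(\<Sum>i\<le>m. of_real (a i) * z ^ (m - i)) = - (\<epsilon> * z ^ m * q)"
    using assms by (simp add: add_eq_0_iff)
  finally have "norm z ^ m * norm q \<le> 1 * norm q"
    using eps by (auto simp: norm_mult norm_power)
  hence "norm z ^ m \<le> 1" using q0 by simp
  moreover have "norm z ^ m > 1" using z m by (intro one_less_power) auto
  ultimately show False by simp
qed

lemma zero_norm_eq_1:
  assumes "poly P z = 0"
  shows "norm z = 1"
proof -
  have z0: "z \<noteq> 0"
  proof
    assume [simp]: "z = 0"
    have "poly P z = (\<Sum>j\<le>m. if j = m then of_real (a j) else 0)"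
      unfolding poly_P using m by (intro sum.cong) (auto simp: power_0_left)
    thus False using assms am by simp
  qed
  have "poly P (1 / z) = \<epsilon> * poly P z / z ^ (2 * m)"
    unfolding poly_P sum_distrib_left sum_divide_distrib
  proof (rule sum.cong)
    fix j assume "j \<in> {..m}"
    hence j: "j \<le> m" by simp
    have "z ^ (2 * m) = z ^ (m - j) * z ^ (m + j)"
      using j by (simp add: power_add [symmetric] mult_2)
    thus "of_real (a j) * ((1 / z) ^ (m - j) + \<epsilon> * (1 / z) ^ (m + j)) =
        \<epsilon> * (of_real (a j) * (z ^ (m - j) + \<epsilon> * z ^ (m + j))) / z ^ (2 * m)"
      using z0 eps by (auto simp: power_one_over field_simps)
  qed auto
  hence "norm (1 / z) \<le> 1" using assms by (intro zero_norm_le_1) simp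
  thus ?thesis using zero_norm_le_1[OF assms] z0 by (simp add: norm_divide divide_le_eq_1)
qed

lemma zeros_on_unit_circle: "zeros_on_unit_circle P"
  unfolding zeros_on_unit_circle_def using zero_norm_eq_1 by blast

lemma degree_P: "degree P = 2 * m" and lead_coeff_P: "lead_coeff P = \<epsilon> * of_real (a m)"
proof -
  have c: "coeff P (2 * m) = \<epsilon> * of_real (a m)"
  proof -
    have "coeff P (2 * m) = (\<Sum>j\<le>m. if j = m then \<epsilon> * of_real (a j) else 0)"
      unfolding P coeff_sum using m by (intro sum.cong) auto
    thus ?thesis by simp
  qed
  show "degree P = 2 * m"
  proof (rule antisym)
    show "degree P \<le> 2 * m" unfolding P
      by (intro degree_sum_le degree_add_le order_trans[OF degree_monom_le]) auto
    show "2 * m \<le> degree P" using c eps am by (intro le_degree) auto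
  qed
  with c show "lead_coeff P = \<epsilon> * of_real (a m)" by simp
qed

lemma norm_poly_P_le:
  assumes "norm w = 1" "w ^ (2 * m) = - \<epsilon>" and small: "\<And>j. j < m \<Longrightarrow> a j \<le> \<eta> * a m"
  shows "norm (poly P w) \<le> norm (lead_coeff P) * (2 * real m * \<eta>)"
proof -
  have nonneg: "a j \<ge> 0" if "j \<le> m" for j
    using that by (induction j) (use a0 mono in \<open>auto intro: order_trans\<close>)
  have top: "1 + \<epsilon> * w ^ (m + m) = 0"
    using assms(2) eps by (auto simp: mult_2)
  have "poly P w = (\<Sum>j<m. of_real (a j) * (w ^ (m - j) + \<epsilon> * w ^ (m + j)))"
    unfolding poly_P by (simp add: lessThan_Suc_atMost[symmetric] top)
  also have "norm \<dots> \<le> (\<Sum>j<m. \<eta> * a m * 2)"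
  proof (rule sum_norm_le)
    fix j assume j: "j \<in> {..<m}"
    have "norm (w ^ (m - j) + \<epsilon> * w ^ (m + j)) \<le> norm (w ^ (m - j)) + norm (\<epsilon> * w ^ (m + j))"
      by (rule norm_triangle_ineq)
    also have "\<dots> = 2" using eps assms by (auto simp: norm_mult norm_power)
    finally show "norm (of_real (a j) * (w ^ (m - j) + \<epsilon> * w ^ (m + j))) \<le> \<eta> * a m * 2"
      unfolding norm_mult using j nonneg[of j] small[of j] by (intro mult_mono) auto
  qed
  also have "\<dots> = norm (lead_coeff P) * (2 * real m * \<eta>)"
    unfolding lead_coeff_P using eps am by (auto simp: norm_mult)
  finally show ?thesis .
qed

end

lemma exists_near_root:
  fixes P :: "complex poly"
  assumes "degree P > 0" "norm (poly P w) \<le> norm (lead_coeff P) * \<delta> ^ degree P" "\<delta> \<ge> 0"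
  shows "\<exists>z. poly P z = 0 \<and> norm (z - w) \<le> \<delta>"
proof (rule ccontr)
  assume "\<not> ?thesis"
  hence far: "norm (z - w) > \<delta>" if "poly P z = 0" for z using that by force
  obtain r :: "nat \<Rightarrow> complex" where r: "smult (lead_coeff P) (\<Prod>i<degree P. [:-r i, 1:]) = P"
    using complex_poly_decompose'[of P] by blast
  have "poly P x = poly (smult (lead_coeff P) (\<Prod>i<degree P. [:-r i, 1:])) x" for x
    using r by (rule arg_cong2[where f = poly, OF sym refl])
  hence pr: "poly P x = lead_coeff P * (\<Prod>i<degree P. x - r i)" for x
    by (simp add: poly_prod)
  have "poly P (r i) = 0" if "i < degree P" for i using that by (subst pr) auto
  hence *: "norm (w - r i) > \<delta>" if "i < degree P" for i
    using far[of "r i"] that by (simp add: norm_minus_commute)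
  have "(\<Prod>i<degree P. \<delta>) < (\<Prod>i<degree P. norm (w - r i))"
    using assms * by (intro prod_mono_strict[where i = 0]) (auto intro: less_imp_le le_less_trans simp del: zero_less_norm_iff)
  hence "norm (lead_coeff P) * \<delta> ^ degree P < norm (poly P w)"
    unfolding pr norm_mult prod_norm [symmetric] using assms(1) by (intro mult_strict_left_mono) auto
  with assms(2) show False by simp
qed

lemma cis_roots_labelling:
  fixes P :: "complex poly"
  assumes deg: "degree P = n" "n > 0"
    and circle: "\<And>z. poly P z = 0 \<Longrightarrow> norm z = 1"
    and near: "\<And>l. l < n \<Longrightarrow> norm (poly P (cis (\<alpha> l))) \<le> norm (lead_coeff P) * \<delta> ^ n"
    and "\<delta> \<ge> 0"
  shows "\<exists>\<theta>. P = smult (lead_coeff P) (\<Prod>l<n. [:- cis (\<theta> l), 1:]) \<and>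
          ((\<forall>l<n. \<forall>l'<n. l \<noteq> l' \<longrightarrow> 2 * \<delta> < norm (cis (\<alpha> l) - cis (\<alpha> l'))) \<longrightarrow>
           (\<forall>l<n. \<exists>u. \<theta> l - \<alpha> l = Arg u \<and> norm (u - 1) \<le> \<delta>))"
proof (cases "\<forall>l<n. \<forall>l'<n. l \<noteq> l' \<longrightarrow> 2 * \<delta> < norm (cis (\<alpha> l) - cis (\<alpha> l'))")
  case False
  obtain r :: "nat \<Rightarrow> complex" where r: "smult (lead_coeff P) (\<Prod>i<n. [:-r i, 1:]) = P"
    using complex_poly_decompose'[of P] deg by blast
  have "poly P (r i) = 0" if "i < n" for i
    using that by (subst r[symmetric]) (auto simp: poly_prod)
  hence "norm (r i) = 1" if "i < n" for i using that circle by blast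
  hence "r i = cis (Arg (r i))" if "i < n" for i
    using that cis_Arg[of "r i"] by (force simp: sgn_eq)
  hence "P = smult (lead_coeff P) (\<Prod>l<n. [:- cis (Arg (r l)), 1:])"
    by (subst r[symmetric]) (auto intro!: prod.cong)
  with False show ?thesis by (intro exI[of _ "\<lambda>l. Arg (r l)"]) blast
next
  case sep: True
  have "\<exists>z. poly P z = 0 \<and> norm (z - cis (\<alpha> l)) \<le> \<delta>" if "l < n" for l
    using exists_near_root[of P] near[OF that] deg \<open>\<delta> \<ge> 0\<close> by simp
  then obtain z where z: "\<And>l. l < n \<Longrightarrow> poly P (z l) = 0" "\<And>l. l < n \<Longrightarrow> norm (z l - cis (\<alpha> l)) \<le> \<delta>"
    by metis
  have inj: "inj_on z {..<n}"
  proof (rule inj_onI, rule ccontr)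
    fix l l' assume l: "l \<in> {..<n}" "l' \<in> {..<n}" "z l = z l'" "l \<noteq> l'"
    have "norm (cis (\<alpha> l) - cis (\<alpha> l')) \<le> norm (cis (\<alpha> l) - z l) + norm (z l - cis (\<alpha> l'))"
      by norm
    also have "\<dots> \<le> 2 * \<delta>" using z(2)[of l] z(2)[of l'] l by (simp add: norm_minus_commute)
    finally show False using sep l by force
  qed
  have P0: "P \<noteq> 0" using deg by auto
  define Q where "Q = smult (lead_coeff P) (\<Prod>l<n. [:- z l, 1:])"
  have "P = Q"
  proof (rule poly_eqI_degree_lead_coeff[where A = "z ` {..<n}" and n = n])
    have dQ: "degree (\<Prod>l<n. [:- z l, 1:]) = n"
      by (subst degree_prod_sum_eq) auto
    thus "degree Q \<le> n" by (simp add: Q_def)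
    have "coeff (\<Prod>l<n. [:- z l, 1:]) n = 1"
      using dQ lead_coeff_prod[of "\<lambda>l. [:- z l, 1:]" "{..<n}"] by simp
    thus "coeff P n = coeff Q n" using deg by (simp add: Q_def)
    show "n \<le> card (z ` {..<n})" using inj by (simp add: card_image)
    show "poly P w = poly Q w" if "w \<in> z ` {..<n}" for w
      using that z(1) by (auto simp: Q_def poly_prod)
  qed (use deg in auto)
  define \<theta> where "\<theta> l = \<alpha> l + Arg (z l / cis (\<alpha> l))" for l
  have cis: "cis (\<theta> l) = z l" if "l < n" for l
  proof -
    have "norm (z l) = 1" using z that circle by blast
    thus ?thesis unfolding \<theta>_def cis_mult[symmetric] by (subst cis_Arg) (auto simp: sgn_eq norm_divide)
  qed
  have "Q = smult (lead_coeff P) (\<Prod>l<n. [:- cis (\<theta> l), 1:])"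
    unfolding Q_def using cis by (auto intro!: prod.cong)
  moreover have "\<exists>u. \<theta> l - \<alpha> l = Arg u \<and> norm (u - 1) \<le> \<delta>" if "l < n" for l
  proof (intro exI[of _ "z l / cis (\<alpha> l)"] conjI)
    have "norm (z l / cis (\<alpha> l) - 1) = norm ((z l - cis (\<alpha> l)) / cis (\<alpha> l))"
      by (simp add: diff_divide_distrib)
    thus "norm (z l / cis (\<alpha> l) - 1) \<le> \<delta>" using z(2)[OF that] by (simp add: norm_divide)
  qed (simp add: \<theta>_def)
  ultimately show ?thesis using \<open>P = Q\<close> by metis
qed

lemma zeros_tend_to_equidistributed_self_inversive:
  fixes a :: "nat \<Rightarrow> nat \<Rightarrow> real" and \<eta> :: "nat \<Rightarrow> real"
  assumes si: "\<And>k. self_inversive m (a k) (\<epsilon> k) (P k)"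
    and small: "\<And>k j. j < m \<Longrightarrow> a k j \<le> \<eta> k * a k m"
    and lim: "\<eta> \<longlonglongrightarrow> 0"
  shows "zeros_tend_to_equidistributed (2 * m) P"
proof -
  define n where "n = 2 * m"
  have m: "m \<ge> 1" using self_inversive.m[OF si] .
  have n: "n > 0" using m by (simp add: n_def)
  define \<phi> :: "nat \<Rightarrow> real" where "\<phi> k = (if \<epsilon> k = 1 then pi / n else 0)" for k
  define \<alpha> where "\<alpha> k l = \<phi> k + 2 * pi * real l / real n" for k l
  define \<delta> where "\<delta> k = root n (2 * real m * \<eta> k)" for k
  have eta: "\<eta> k \<ge> 0" for k
  proof -
    have "0 \<le> \<eta> k * a k m" using small[of 0 k] m self_inversive.a0[OF si, of k] by simp
    thus ?thesis using self_inversive.am[OF si, of k] by (simp add: zero_le_mult_iff)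
  qed
  have pow: "cis (\<alpha> k l) ^ (2 * m) = - \<epsilon> k" for k l
  proof -
    have "cis (\<alpha> k l) ^ n = cis (real n * \<phi> k + 2 * pi * real l)"
      unfolding \<alpha>_def Complex.DeMoivre using n by (simp add: distrib_left)
    also have "\<dots> = cis (real n * \<phi> k)"
      by (simp add: cis_mult[symmetric] cis_multiple_2pi)
    also have "\<dots> = - \<epsilon> k"
      using self_inversive.eps[OF si, of k] n by (auto simp: \<phi>_def)
    finally show ?thesis by (simp add: n_def)
  qed
  have "\<exists>\<theta>. P k = smult (lead_coeff (P k)) (\<Prod>l<n. [:- cis (\<theta> l), 1:]) \<and>
          ((\<forall>l<n. \<forall>l'<n. l \<noteq> l' \<longrightarrow> 2 * \<delta> k < norm (cis (\<alpha> k l) - cis (\<alpha> k l'))) \<longrightarrow>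
           (\<forall>l<n. \<exists>u. \<theta> l - \<alpha> k l = Arg u \<and> norm (u - 1) \<le> \<delta> k))" for k
  proof (rule cis_roots_labelling)
    show "degree (P k) = n" using self_inversive.degree_P[OF si] by (simp add: n_def)
    show "norm z = 1" if "poly (P k) z = 0" for z using self_inversive.zero_norm_eq_1[OF si that] .
    show "norm (poly (P k) (cis (\<alpha> k l))) \<le> norm (lead_coeff (P k)) * \<delta> k ^ n" for l
      using self_inversive.norm_poly_P_le[OF si, of "cis (\<alpha> k l)" k "\<eta> k"] pow small eta n
      by (simp add: \<delta>_def)
    show "\<delta> k \<ge> 0" using eta n by (simp add: \<delta>_def)
  qed (use n in auto)
  then obtain \<theta> where \<theta>:
    "\<And>k. P k = smult (lead_coeff (P k)) (\<Prod>l<n. [:- cis (\<theta> k l), 1:])"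
    "\<And>k. (\<forall>l<n. \<forall>l'<n. l \<noteq> l' \<longrightarrow> 2 * \<delta> k < norm (cis (\<alpha> k l) - cis (\<alpha> k l'))) \<Longrightarrow>
           (\<forall>l<n. \<exists>u. \<theta> k l - \<alpha> k l = Arg u \<and> norm (u - 1) \<le> \<delta> k)"
    by metis
  have \<delta>0: "\<delta> \<longlonglongrightarrow> 0"
  proof -
    have "\<delta> \<longlonglongrightarrow> root n (2 * real m * 0)" unfolding \<delta>_def by (intro tendsto_intros lim)
    thus ?thesis by simp
  qed
  have dist: "norm (cis (\<alpha> k l) - cis (\<alpha> k l')) = norm (cis (2 * pi * real l / real n) - cis (2 * pi * real l' / real n))"
    for k l l'
  proof -
    have "cis (\<alpha> k l) - cis (\<alpha> k l') = cis (\<phi> k) * (cis (2 * pi * real l / real n) - cis (2 * pi * real l' / real n))"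
      by (simp add: \<alpha>_def cis_mult[symmetric] algebra_simps)
    thus ?thesis by (simp add: norm_mult)
  qed
  have "\<forall>\<^sub>F k in sequentially. \<forall>l\<in>{..<n}. \<forall>l'\<in>{..<n}. l \<noteq> l' \<longrightarrow>
          2 * \<delta> k < norm (cis (\<alpha> k l) - cis (\<alpha> k l'))"
  proof (intro eventually_ball_finite ballI finite_lessThan)
    fix l l' assume l: "l \<in> {..<n}" "l' \<in> {..<n}"
    show "\<forall>\<^sub>F k in sequentially. l \<noteq> l' \<longrightarrow> 2 * \<delta> k < norm (cis (\<alpha> k l) - cis (\<alpha> k l'))"
    proof (cases "l = l'")
      case False
      have "cis (2 * pi * real l / real n) \<noteq> cis (2 * pi * real l' / real n)"
        using Complex.bij_betw_roots_unity[of n] n l False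
        by (auto simp: bij_betw_def inj_on_def)
      hence "norm (cis (2 * pi * real l / real n) - cis (2 * pi * real l' / real n)) > 0" by simp
      moreover have "(\<lambda>k. 2 * \<delta> k) \<longlonglongrightarrow> 2 * 0" by (intro tendsto_intros \<delta>0)
      ultimately have "\<forall>\<^sub>F k in sequentially. 2 * \<delta> k < norm (cis (\<alpha> k l) - cis (\<alpha> k l'))"
        unfolding dist by (simp only: order_tendstoD(2) mult_zero_right)
      thus ?thesis by eventually_elim simp
    qed auto
  qed
  hence ev: "\<forall>\<^sub>F k in sequentially. \<forall>l<n. \<exists>u. \<theta> k l - \<alpha> k l = Arg u \<and> norm (u - 1) \<le> \<delta> k"
    by eventually_elim (use \<theta>(2) in auto)
  have "(\<lambda>k. \<theta> k l - \<alpha> k l) \<longlonglongrightarrow> 0" if l: "l < n" for l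
  proof (rule tendstoI)
    fix e :: real assume e: "e > 0"
    have "isCont Arg 1" by (rule continuous_at_Arg) auto
    then obtain d where d: "d > 0" "\<And>u. dist u 1 < d \<Longrightarrow> dist (Arg u) (Arg 1) < e"
      using e unfolding continuous_at_eps_delta by blast
    have "\<forall>\<^sub>F k in sequentially. \<delta> k < d" using \<delta>0 d(1) by (rule order_tendstoD(2))
    with ev show "\<forall>\<^sub>F k in sequentially. dist (\<theta> k l - \<alpha> k l) 0 < e"
    proof eventually_elim
      case (elim k)
      then obtain u where "\<theta> k l - \<alpha> k l = Arg u" "norm (u - 1) \<le> \<delta> k" using l by blast
      with d(2)[of u] elim show ?case by (simp add: dist_norm)
    qed
  qed
  moreover have "P k \<noteq> 0" for k
    using self_inversive.degree_P[OF si, of k] n by (auto simp: n_def)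
  ultimately show ?thesis
    unfolding zeros_tend_to_equidistributed_def n_def[symmetric] using \<theta>(1)
    by (intro exI[of _ \<theta>] exI[of _ \<phi>]) (auto simp: \<alpha>_def)
qed

section \<open>Entire functions of order less than two\<close>

lemma entire_factor_out_zero:
  assumes F: "F holomorphic_on UNIV" and "F 0 \<noteq> 0" "F \<rho> = 0"
  obtains G n where "G holomorphic_on UNIV" "G \<rho> \<noteq> 0" "\<And>z. F z = (1 - z / \<rho>) ^ n * G z"
proof -
  have \<rho>: "\<rho> \<noteq> 0" using assms by metis
  define n where "n = nat (zorder F \<rho>)"
  define g where "g = zor_poly F \<rho>"
  obtain r where r: "r > 0" "g holomorphic_on cball \<rho> r"
    "\<And>w. w \<in> cball \<rho> r \<Longrightarrow> F w = g w * (w - \<rho>) ^ n \<and> g w \<noteq> 0"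
    using zorder_exist_zero[of F UNIV \<rho>] F assms(2) unfolding n_def g_def by (auto simp del: mem_cball)
  define G where "G z = (if z = \<rho> then g \<rho> else F z / (z - \<rho>) ^ n)" for z
  have "G holomorphic_on (ball \<rho> r \<union> (- {\<rho>}))"
  proof (rule holomorphic_on_Un)
    have "g holomorphic_on ball \<rho> r" using r(2) by (rule holomorphic_on_subset) auto
    moreover have "G z = g z" if "z \<in> ball \<rho> r" for z
      using r(3)[of z] that by (auto simp: G_def)
    ultimately show "G holomorphic_on ball \<rho> r" by (rule holomorphic_transform[OF _ sym])
    have "(\<lambda>z. F z / (z - \<rho>) ^ n) holomorphic_on - {\<rho>}"
      by (intro holomorphic_intros holomorphic_on_subset[OF F]) auto
    thus "G holomorphic_on - {\<rho>}"
      by (rule holomorphic_transform) (auto simp: G_def)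
  qed auto
  also have "ball \<rho> r \<union> (- {\<rho>}) = UNIV" using r(1) by auto
  finally have holG: "G holomorphic_on UNIV" .
  have FG: "F z = (z - \<rho>) ^ n * G z" for z
    using r(1) r(3)[of \<rho>] by (auto simp: G_def)
  show ?thesis
  proof (rule that)
    show "(\<lambda>z. (- \<rho>) ^ n * G z) holomorphic_on UNIV" by (intro holomorphic_intros holG)
    show "(- \<rho>) ^ n * G \<rho> \<noteq> 0" using \<rho> r(1) r(3)[of \<rho>] by (auto simp: G_def)
    show "F z = (1 - z / \<rho>) ^ n * ((- \<rho>) ^ n * G z)" for z
    proof -
      have "(1 - z / \<rho>) * (- \<rho>) = z - \<rho>" using \<rho> by (simp add: field_simps)
      thus ?thesis by (simp add: FG mult.assoc[symmetric] power_mult_distrib[symmetric])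
    qed
  qed
qed

lemma entire_factor_out_zeros:
  fixes K :: "complex set"
  assumes "F holomorphic_on UNIV" "F 0 \<noteq> 0" "compact K"
  obtains G and Z :: "complex set" and n where
    "G holomorphic_on UNIV" "\<And>z. z \<in> K \<Longrightarrow> G z \<noteq> 0" "finite Z" "Z \<subseteq> K"
    "\<And>\<rho>. \<rho> \<in> Z \<Longrightarrow> F \<rho> = 0" "\<And>z. F z = (\<Prod>\<rho>\<in>Z. (1 - z / \<rho>) ^ n \<rho>) * G z"
proof -
  have fin: "finite {z \<in> K. F z = 0}"
  proof (cases "F constant_on UNIV")
    case True
    thus ?thesis using assms(2) by (auto simp: constant_on_def)
  next
    case False
    thus ?thesis using assms by (intro holomorphic_compact_finite_zeros[where S = UNIV]) auto
  qed
  have "\<exists>G n. G holomorphic_on UNIV \<and> (\<forall>z\<in>Z. G z \<noteq> 0) \<and> (\<forall>z. F z = (\<Prod>\<rho>\<in>Z. (1 - z / \<rho>) ^ n \<rho>) * G z)"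
    if "finite Z" "Z \<subseteq> {z \<in> K. F z = 0}" for Z
    using that
  proof (induction Z rule: finite_induct)
    case empty
    thus ?case using assms by (intro exI[of _ F]) auto
  next
    case (insert \<rho> Z)
    then obtain G n where G: "G holomorphic_on UNIV" "\<forall>z\<in>Z. G z \<noteq> 0"
      "\<And>z. F z = (\<Prod>\<rho>\<in>Z. (1 - z / \<rho>) ^ n \<rho>) * G z" by auto
    have G0: "G 0 \<noteq> 0" using assms(2) G(3)[of 0] by auto
    show ?case
    proof (cases "G \<rho> = 0")
      case True
      then obtain H k where H: "H holomorphic_on UNIV" "H \<rho> \<noteq> 0" "\<And>z. G z = (1 - z / \<rho>) ^ k * H z"
        using entire_factor_out_zero[OF G(1) G0] by blast
      show ?thesis
      proof (intro exI[of _ H] exI[of _ "n(\<rho> := k)"] conjI allI)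
        show "F z = (\<Prod>\<rho>'\<in>insert \<rho> Z. (1 - z / \<rho>') ^ (n(\<rho> := k)) \<rho>') * H z" for z
        proof -
          have "(\<Prod>\<rho>'\<in>Z. (1 - z / \<rho>') ^ (n(\<rho> := k)) \<rho>') = (\<Prod>\<rho>'\<in>Z. (1 - z / \<rho>') ^ n \<rho>')"
            using insert by (intro prod.cong) auto
          thus ?thesis using insert G(3)[of z] H(3)[of z] by simp
        qed
      qed (use G H in auto)
    next
      case False
      show ?thesis
      proof (intro exI[of _ G] exI[of _ "n(\<rho> := 0)"] conjI allI)
        show "F z = (\<Prod>\<rho>'\<in>insert \<rho> Z. (1 - z / \<rho>') ^ (n(\<rho> := 0)) \<rho>') * G z" for z
        proof -
          have "(\<Prod>\<rho>'\<in>Z. (1 - z / \<rho>') ^ (n(\<rho> := 0)) \<rho>') = (\<Prod>\<rho>'\<in>Z. (1 - z / \<rho>') ^ n \<rho>')"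
            using insert by (intro prod.cong) auto
          thus ?thesis using insert G(3)[of z] by simp
        qed
      qed (use G False in auto)
    qed
  qed
  from this[OF fin] obtain G n where G: "G holomorphic_on UNIV" "\<And>z. z \<in> {z \<in> K. F z = 0} \<Longrightarrow> G z \<noteq> 0"
    "\<And>z. F z = (\<Prod>\<rho>\<in>{z \<in> K. F z = 0}. (1 - z / \<rho>) ^ n \<rho>) * G z" by blast
  show ?thesis
  proof (rule that[OF G(1) _ fin _ _ G(3)])
    show "G z \<noteq> 0" if "z \<in> K" for z
    proof
      assume "G z = 0"
      hence "F z = 0" using G(3)[of z] by simp
      thus False using G(2)[of z] that \<open>G z = 0\<close> by simp
    qed
  qed auto
qed

lemma borel_caratheodory_half_ball:
  fixes k :: "complex \<Rightarrow> complex"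
  assumes hol: "k holomorphic_on ball 0 R" and "R > 0" and k0: "k 0 = 0" and "A > 0"
    and Re: "\<And>z. z \<in> ball 0 R \<Longrightarrow> Re (k z) < A" and z: "norm z \<le> R / 2"
  shows "norm (k z) \<le> 2 * A"
proof -
  define \<phi> where "\<phi> w = k (of_real R * w) / (of_real (2 * A) - k (of_real R * w))" for w
  have inb: "of_real R * w \<in> ball 0 R" if "norm w < 1" for w :: complex
    using that \<open>R > 0\<close> by (simp add: norm_mult)
  have lt: "norm (k u) < norm (of_real (2 * A) - k u)" if "u \<in> ball 0 R" for u
  proof (rule power2_less_imp_less)
    have "(norm (of_real (2 * A) - k u))\<^sup>2 - (norm (k u))\<^sup>2 = 4 * A * (A - Re (k u))"
      unfolding cmod_power2 by (simp add: power2_eq_square algebra_simps)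
    also have "\<dots> > 0" using Re[OF that] \<open>A > 0\<close> by simp
    finally show "(norm (k u))\<^sup>2 < (norm (of_real (2 * A) - k u))\<^sup>2" by simp
  qed auto
  have ne: "of_real (2 * A) - k u \<noteq> 0" if "u \<in> ball 0 R" for u
    using lt[OF that] by auto
  define w where "w = z / of_real R"
  have w: "norm w \<le> 1 / 2" using z \<open>R > 0\<close> by (simp add: w_def norm_divide field_simps)
  have "norm (\<phi> w) \<le> norm w"
  proof (rule Schwarz_Lemma(1))
    have "(k \<circ> (\<lambda>w. of_real R * w)) holomorphic_on ball 0 1"
      by (rule holomorphic_on_compose_gen[OF _ hol]) (auto intro!: holomorphic_intros inb simp del: mem_ball simp: dist_norm)
    hence "(\<lambda>w. k (of_real R * w)) holomorphic_on ball 0 1" by (simp add: o_def)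
    thus "\<phi> holomorphic_on ball 0 1" unfolding \<phi>_def
      using ne inb by (intro holomorphic_intros) auto
    show "\<phi> 0 = 0" by (simp add: \<phi>_def k0)
    show "norm (\<phi> v) < 1" if "norm v < 1" for v
      using lt[OF inb[OF that]] unfolding \<phi>_def norm_divide
      by (subst divide_less_eq_1_pos) (auto intro: le_less_trans[OF norm_ge_zero])
  qed (use w in auto)
  with w have \<phi>w: "norm (\<phi> w) \<le> 1 / 2" by simp
  have wz: "of_real R * w = z" using \<open>R > 0\<close> by (simp add: w_def)
  have "norm w < 1" using w by simp
  note zb = inb[OF this, unfolded wz]
  have "norm (k z) = norm (\<phi> w) * norm (of_real (2 * A) - k z)"
    using ne[OF zb] by (simp add: \<phi>_def wz norm_divide)
  also have "\<dots> \<le> 1 / 2 * (norm (of_real (2 * A) :: complex) + norm (k z))"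
    using \<phi>w by (intro mult_mono norm_triangle_ineq4) auto
  also have "norm (of_real (2 * A) :: complex) = 2 * A" using \<open>A > 0\<close> by (simp only: norm_of_real)
  finally show ?thesis by simp
qed

lemma norm_even_part_le:
  fixes k :: "complex \<Rightarrow> complex"
  assumes hol: "k holomorphic_on ball 0 R" and k0: "k 0 = 0" and "A > 0"
    and Re: "\<And>z. z \<in> ball 0 R \<Longrightarrow> Re (k z) < A" and "R > 0" "norm x \<le> R / 8"
  shows "norm (k x + k (- x)) \<le> 512 * A * (norm x)\<^sup>2 / R\<^sup>2"
proof -
  define K where "K z = k z + k (- z)" for z
  have "(k \<circ> uminus) holomorphic_on ball 0 R"
    by (rule holomorphic_on_compose_gen[OF _ hol]) (auto intro!: holomorphic_intros)
  hence holK: "K holomorphic_on ball 0 R"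
    unfolding K_def by (intro holomorphic_intros hol) (simp add: o_def)
  have bound: "norm (K z) \<le> 4 * A" if "norm z \<le> R / 2" for z
  proof -
    have "norm (K z) \<le> norm (k z) + norm (k (- z))" unfolding K_def by (rule norm_triangle_ineq)
    also have "\<dots> \<le> 2 * A + 2 * A"
      using assms that by (intro add_mono borel_caratheodory_half_ball[OF hol]) auto
    finally show ?thesis by simp
  qed
  have "norm ((deriv ^^ 0) K x - (\<Sum>i\<le>1. (deriv ^^ i) K 0 * (x - 0) ^ i / fact i)) \<le>
          (fact 2 * (4 * A) / (R / 8) ^ 2) * norm (x - 0) ^ Suc 1 / fact 1"
  proof (rule complex_Taylor[where S = "ball 0 (R / 4)" and f = "\<lambda>i. (deriv ^^ i) K"])
    show "(((deriv ^^ i) K) has_field_derivative (deriv ^^ Suc i) K z) (at z within ball 0 (R / 4))"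
      if "z \<in> ball 0 (R / 4)" for i z
    proof -
      have "(deriv ^^ i) K holomorphic_on ball 0 R" by (rule holomorphic_higher_deriv[OF holK]) auto
      hence "((deriv ^^ i) K has_field_derivative deriv ((deriv ^^ i) K) z) (at z)"
        using that \<open>R > 0\<close> norm_ge_zero[of z]
        by (intro holomorphic_derivI[where S = "ball 0 R"]) (auto simp del: norm_ge_zero)
      thus ?thesis by (simp add: has_field_derivative_at_within)
    qed
    show "norm ((deriv ^^ Suc 1) K z) \<le> fact 2 * (4 * A) / (R / 8) ^ 2" if z: "z \<in> ball 0 (R / 4)" for z
    proof -
      have "norm ((deriv ^^ 2) K z) \<le> fact 2 * (4 * A) / (R / 8) ^ 2"
      proof (rule Cauchy_inequality)
        have sub: "cball z (R / 8) \<subseteq> ball 0 R"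
        proof
          fix y assume "y \<in> cball z (R / 8)"
          moreover have "norm y \<le> norm z + dist z y" by (simp add: dist_norm) norm
          ultimately show "y \<in> ball 0 R" using z \<open>R > 0\<close> by simp
        qed
        show "K holomorphic_on ball z (R / 8)"
          using sub by (intro holomorphic_on_subset[OF holK]) auto
        show "continuous_on (cball z (R / 8)) K"
          using sub holK by (meson holomorphic_on_imp_continuous_on continuous_on_subset)
        show "norm (K y) \<le> 4 * A" if "norm (z - y) = R / 8" for y
        proof (rule bound)
          have "norm y \<le> norm z + norm (z - y)" by norm
          thus "norm y \<le> R / 2" using that z norm_ge_zero[of z] by (simp del: norm_ge_zero)
        qed
      qed (use \<open>R > 0\<close> in auto)
      thus ?thesis by (simp add: numeral_2_eq_2)
    qed
  qed (use assms in auto)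
  moreover have "deriv K 0 = 0"
  proof -
    have k': "(k has_field_derivative deriv k 0) (at 0)"
      using \<open>R > 0\<close> by (intro holomorphic_derivI[OF hol]) auto
    hence "(k has_field_derivative deriv k 0) (at (- 0))" by simp
    hence "((\<lambda>z. k (- z)) has_field_derivative deriv k 0 * (- 1)) (at 0)"
      by (rule DERIV_chain2[where g = uminus]) (auto intro!: derivative_eq_intros)
    from DERIV_add[OF k' this] have "(K has_field_derivative 0) (at 0)"
      unfolding K_def by simp
    thus ?thesis by (rule DERIV_imp_deriv)
  qed
  moreover have "K 0 = 0" by (simp add: K_def k0)
  ultimately have "norm (K x) \<le> 512 * A * (norm x)\<^sup>2 / R\<^sup>2"
    by (simp add: power2_eq_square field_simps)
  thus ?thesis by (simp add: K_def)
qed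

text \<open>
  Instead of a full Hadamard product, divide out the finitely many zeros in a large disc of radius
  \<open>R\<close>. The quotient is \<open>exp k\<close> with \<open>k x + k (- x) = O(R powr (a - 2))\<close>, as the linear
  terms cancel.
\<close>

lemma norm_square_le_of_zeros:
  fixes F :: "complex \<Rightarrow> complex" and x :: complex
  assumes F: "F holomorphic_on UNIV"
    and growth: "\<And>z. norm z \<ge> R0 \<Longrightarrow> norm (F z) \<le> C * exp (c * norm z powr a)" and "a < 2" 
    and zeros: "\<And>\<rho>. F \<rho> = 0 \<Longrightarrow> norm (\<rho>\<^sup>2) \<le> norm (\<rho>\<^sup>2 - x\<^sup>2)"
  shows "(norm (F 0))\<^sup>2 \<le> norm (F x) * norm (F (- x))"
proof (cases "F 0 = 0")
  case F0: False
  define A where "A R = ln (max C 1) + max c 0 * (2 * R) powr a + max 0 (- ln (norm (F 0))) + 1" for R :: real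
  have bound: "(norm (F 0))\<^sup>2 * exp (- (512 * A R * (norm x)\<^sup>2 / R\<^sup>2)) \<le> norm (F x) * norm (F (- x))"
    if R: "R > R0" "R > 0" "R \<ge> 8 * norm x" for R
  proof -
    obtain G and Z :: "complex set" and n where G: "G holomorphic_on UNIV" "\<And>z. z \<in> cball 0 R \<Longrightarrow> G z \<noteq> 0" "finite Z" "Z \<subseteq> cball 0 R"
      "\<And>\<rho>. \<rho> \<in> Z \<Longrightarrow> F \<rho> = 0" "\<And>z. F z = (\<Prod>\<rho>\<in>Z. (1 - z / \<rho>) ^ n \<rho>) * G z"
      using entire_factor_out_zeros[OF F F0 compact_cball, of 0 R] by blast
    have Z0: "\<rho> \<noteq> 0" if "\<rho> \<in> Z" for \<rho> using G(5)[OF that] F0 by metis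
    define M where "M = max C 1 * exp (max c 0 * (2 * R) powr a)"
    have G0: "G 0 = F 0" using G(6)[of 0] by simp
    have GM: "norm (G z) \<le> M" if "z \<in> cball 0 (2 * R)" for z
    proof (rule maximum_modulus_frontier[where f = G and S = "cball 0 (2 * R)"])
      fix y :: complex assume "y \<in> frontier (cball 0 (2 * R))"
      hence y: "norm y = 2 * R" using R by simp
      have "1 \<le> (\<Prod>\<rho>\<in>Z. norm ((1 - y / \<rho>) ^ n \<rho>))"
      proof (intro prod_ge_1)
        fix \<rho> assume \<rho>: "\<rho> \<in> Z"
        hence "norm \<rho> \<le> R" using G(4) by auto
        hence "norm (y / \<rho>) \<ge> 2" using y Z0[OF \<rho>] R by (simp add: norm_divide field_simps)
        moreover have "norm (y / \<rho>) \<le> norm (1 - y / \<rho>) + 1"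
          using norm_triangle_ineq4[of 1 "1 - y / \<rho>"] by simp
        ultimately have "norm (1 - y / \<rho>) \<ge> 1" by linarith
        thus "1 \<le> norm ((1 - y / \<rho>) ^ n \<rho>)" by (simp add: norm_power one_le_power)
      qed
      hence "1 * norm (G y) \<le> norm (\<Prod>\<rho>\<in>Z. (1 - y / \<rho>) ^ n \<rho>) * norm (G y)"
        by (intro mult_right_mono) (auto simp: prod_norm)
      also have "\<dots> = norm (F y)" by (simp add: G(6)[of y] norm_mult)
      also have "\<dots> \<le> C * exp (c * norm y powr a)" using y R by (intro growth) auto
      also have "\<dots> \<le> M" unfolding M_def y by (intro mult_mono) (auto intro!: mult_right_mono)
      finally show "norm (G y) \<le> M" by simp
    qed (use that G(1) in \<open>auto intro: holomorphic_on_subset holomorphic_on_imp_continuous_on continuous_on_subset\<close>)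
    have "G holomorphic_on ball 0 R" using G(1) by (rule holomorphic_on_subset) auto
    moreover have "G z \<noteq> 0" if "z \<in> ball 0 R" for z using G(2)[of z] that by auto
    ultimately obtain h where h: "h holomorphic_on ball 0 R" "\<And>z. z \<in> ball 0 R \<Longrightarrow> exp (h z) = G z"
      using holomorphic_logarithm_exists[of "ball 0 R" G 0] R by auto
    define k where "k z = h z - h 0" for z
    have expk: "exp (k z) = G z / F 0" if "z \<in> ball 0 R" for z
      using h(2)[OF that] h(2)[of 0] R by (simp add: k_def exp_diff G0)
    have "norm (k x + k (- x)) \<le> 512 * A R * (norm x)\<^sup>2 / R\<^sup>2"
    proof (rule norm_even_part_le)
      show "k holomorphic_on ball 0 R" unfolding k_def by (intro holomorphic_intros h)
      show "A R > 0" unfolding A_def by (intro add_nonneg_pos add_nonneg_nonneg) auto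
      show "Re (k z) < A R" if z: "z \<in> ball 0 R" for z
      proof -
        have "exp (Re (k z)) = norm (G z) / norm (F 0)"
          using expk[OF z] by (metis norm_divide norm_exp_eq_Re)
        also have "\<dots> \<le> M / norm (F 0)" using GM[of z] z R by (intro divide_right_mono) auto
        also have "\<dots> = exp (ln (M / norm (F 0)))"
          using F0 by (subst exp_ln) (auto simp: M_def intro!: divide_pos_pos mult_pos_pos)
        finally have "Re (k z) \<le> ln (M / norm (F 0))" by simp
        also have "\<dots> = ln (max C 1) + max c 0 * (2 * R) powr a - ln (norm (F 0))"
          using F0 unfolding M_def by (subst ln_div) (auto simp: ln_mult)
        also have "\<dots> < A R" by (simp add: A_def)
        finally show ?thesis .
      qed
    qed (use R in \<open>auto simp: k_def\<close>)
    hence "exp (- (512 * A R * (norm x)\<^sup>2 / R\<^sup>2)) \<le> exp (Re (k x + k (- x)))"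
      using abs_Re_le_cmod[of "k x + k (- x)"] by (subst exp_le_cancel_iff) linarith
    also have "\<dots> = norm (exp (k x) * exp (k (- x)))"
      by (simp add: exp_add[symmetric])
    also have "\<dots> = norm (G x) * norm (G (- x)) / (norm (F 0))\<^sup>2"
    proof -
      have "norm x < R" using R by (cases "x = 0") auto
      thus ?thesis by (simp add: expk norm_mult norm_divide power2_eq_square)
    qed
    finally have "(norm (F 0))\<^sup>2 * exp (- (512 * A R * (norm x)\<^sup>2 / R\<^sup>2)) \<le> 1 * (norm (G x) * norm (G (- x)))"
      using F0 by (simp add: field_simps)
    also have "1 \<le> (\<Prod>\<rho>\<in>Z. norm (((1 - x / \<rho>) * (1 - (- x) / \<rho>)) ^ n \<rho>))"
    proof (intro prod_ge_1)
      fix \<rho> assume \<rho>: "\<rho> \<in> Z"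
      have "(1 - x / \<rho>) * (1 - (- x) / \<rho>) = (\<rho>\<^sup>2 - x\<^sup>2) / \<rho>\<^sup>2"
        using Z0[OF \<rho>] by (simp add: field_simps power2_eq_square)
      also have "norm \<dots> \<ge> 1"
        using zeros[OF G(5)[OF \<rho>]] Z0[OF \<rho>] by (simp add: norm_divide le_divide_eq)
      finally show "1 \<le> norm (((1 - x / \<rho>) * (1 - (- x) / \<rho>)) ^ n \<rho>)"
        by (simp only: norm_power one_le_power)
    qed
    hence "1 * (norm (G x) * norm (G (- x))) \<le> \<dots> * (norm (G x) * norm (G (- x)))"
      by (intro mult_right_mono) auto
    also have "\<dots> = norm (F x) * norm (F (- x))"
      by (simp add: G(6)[of x] G(6)[of "- x"] norm_mult prod_norm power_mult_distrib prod.distrib)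
    finally show ?thesis .
  qed
  have "((\<lambda>R. (norm (F 0))\<^sup>2 * exp (- (512 * A R * (norm x)\<^sup>2 / R\<^sup>2))) \<longlongrightarrow> (norm (F 0))\<^sup>2 * exp (- (512 * 0 * (norm x)\<^sup>2))) at_top"
  proof -
    have "((\<lambda>R :: real. K / R\<^sup>2) \<longlongrightarrow> 0) at_top" for K :: real by real_asymp
    moreover have "((\<lambda>R :: real. (2 * R) powr a / R\<^sup>2) \<longlongrightarrow> 0) at_top"
      using \<open>a < 2\<close> by real_asymp
    ultimately have "((\<lambda>R. (ln (max C 1) + max 0 (- ln (norm (F 0))) + 1) / R\<^sup>2 + max c 0 * ((2 * R) powr a / R\<^sup>2)) \<longlongrightarrow> 0 + max c 0 * 0) at_top"
      by (intro tendsto_add tendsto_mult tendsto_const)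
    moreover have "A R / R\<^sup>2 = (ln (max C 1) + max 0 (- ln (norm (F 0))) + 1) / R\<^sup>2 + max c 0 * ((2 * R) powr a / R\<^sup>2)" for R
      by (simp only: A_def add_divide_distrib times_divide_eq_right add_ac)
    ultimately have "((\<lambda>R. A R / R\<^sup>2) \<longlongrightarrow> 0) at_top" by simp
    hence "((\<lambda>R. (norm (F 0))\<^sup>2 * exp (- (512 * (A R / R\<^sup>2) * (norm x)\<^sup>2))) \<longlongrightarrow> (norm (F 0))\<^sup>2 * exp (- (512 * 0 * (norm x)\<^sup>2))) at_top"
      by (intro tendsto_intros)
    thus ?thesis by simp
  qed
  moreover have "\<forall>\<^sub>F R in at_top. (norm (F 0))\<^sup>2 * exp (- (512 * A R * (norm x)\<^sup>2 / R\<^sup>2)) \<le> norm (F x) * norm (F (- x))"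
    using eventually_gt_at_top[of R0] eventually_gt_at_top[of 0] eventually_ge_at_top[of "8 * norm x"]
    by eventually_elim (rule bound)
  ultimately have "(norm (F 0))\<^sup>2 * exp (- (512 * 0 * (norm x)\<^sup>2)) \<le> norm (F x) * norm (F (- x))"
    by (rule tendsto_upperbound) auto
  thus ?thesis by simp
qed auto

section \<open>Euler products\<close>

lemma summable_zeta_real:
  assumes "\<sigma> > 1"
  shows "summable (\<lambda>n. real n powr - \<sigma>)" "summable (\<lambda>n. 1 / real (Suc n) powr \<sigma>)"
proof -
  show 1: "summable (\<lambda>n. real n powr - \<sigma>)" using assms by (simp add: summable_real_powr_iff)
  hence "summable (\<lambda>n. real (Suc n) powr - \<sigma>)" by (subst summable_Suc_iff)
  thus "summable (\<lambda>n. 1 / real (Suc n) powr \<sigma>)" by (simp add: powr_minus divide_inverse)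
qed

lemma has_sum_zeta_real:
  assumes "\<sigma> > 1"
  shows "((\<lambda>n. real n powr - \<sigma>) has_sum zeta_real \<sigma>) UNIV"
proof (rule norm_summable_imp_has_sum)
  show "summable (\<lambda>n. norm (real n powr - \<sigma>))" using summable_zeta_real(1)[OF assms] by simp
  have "(\<lambda>n. 1 / real (Suc n) powr \<sigma>) sums zeta_real \<sigma>"
    unfolding zeta_real_def using summable_zeta_real(2)[OF assms] by (rule summable_sums)
  hence "(\<lambda>n. real (Suc n) powr - \<sigma>) sums zeta_real \<sigma>" by (simp add: powr_minus divide_inverse)
  thus "(\<lambda>n. real n powr - \<sigma>) sums zeta_real \<sigma>" by (subst (asm) sums_Suc_iff) simp
qed

lemma has_sum_euler_sieve:
  assumes "\<sigma> > 1" "finite Q" "\<And>p. p \<in> Q \<Longrightarrow> prime (p :: nat)"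
  shows "((\<lambda>n. real n powr - \<sigma>) has_sum ((\<Prod>p\<in>Q. 1 - real p powr - \<sigma>) * zeta_real \<sigma>)) {n. \<forall>p\<in>Q. \<not> p dvd n}"
  using assms(2,3)
proof (induction Q rule: finite_induct)
  case empty
  show ?case using has_sum_zeta_real[OF assms(1)] by simp
next
  case (insert p Q)
  let ?h = "\<lambda>n. real n powr - \<sigma>" and ?E = "{n. \<forall>q\<in>Q. \<not> q dvd n}"
  let ?s = "(\<Prod>p\<in>Q. 1 - real p powr - \<sigma>) * zeta_real \<sigma>"
  have IH: "(?h has_sum ?s) ?E" using insert by auto
  have p: "prime p" using insert by auto
  hence p0: "p > 0" by (rule prime_gt_0_nat)
  have "((\<lambda>n. ?h p * ?h n) has_sum (?h p * ?s)) ?E" by (rule has_sum_cmult_right[OF IH])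
  hence "((?h \<circ> (\<lambda>n. p * n)) has_sum (?h p * ?s)) ?E"
    by (simp add: o_def powr_mult)
  hence "(?h has_sum (?h p * ?s)) ((\<lambda>n. p * n) ` ?E)"
    using p0 by (subst has_sum_reindex) (auto simp: inj_on_def)
  moreover have sub: "(\<lambda>n. p * n) ` ?E \<subseteq> ?E"
  proof clarify
    fix n q assume n: "\<forall>q\<in>Q. \<not> q dvd n" and q: "q \<in> Q" "q dvd p * n"
    have "q dvd p" using n q insert by (auto simp: prime_dvd_mult_iff)
    hence "q = p" using q insert p by (simp add: primes_dvd_imp_eq)
    thus False using q insert by simp
  qed
  ultimately have "(?h has_sum (?s - ?h p * ?s)) (?E - (\<lambda>n. p * n) ` ?E)"
    using IH by (intro has_sum_Diff) auto
  also have "?E - (\<lambda>n. p * n) ` ?E = {n. \<forall>q\<in>insert p Q. \<not> q dvd n}"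
  proof (intro equalityI subsetI)
    fix n assume n: "n \<in> ?E - (\<lambda>n. p * n) ` ?E"
    have "\<not> p dvd n"
    proof
      assume "p dvd n"
      then obtain k where "n = p * k" by (elim dvdE)
      moreover have "k \<in> ?E" using n calculation by auto
      ultimately show False using n by blast
    qed
    thus "n \<in> {n. \<forall>q\<in>insert p Q. \<not> q dvd n}" using n by auto
  qed auto
  finally show ?case using insert by (simp add: algebra_simps)
qed

lemma euler_product_zeta_real:
  assumes "\<sigma> > 1"
  shows "(\<lambda>n. \<Prod>p\<le>n. if prime p then 1 / (1 - real p powr - \<sigma>) else 1) \<longlonglongrightarrow> zeta_real \<sigma>"
proof -
  let ?h = "\<lambda>n. real n powr - \<sigma>"
  let ?P = "\<lambda>n. \<Prod>p\<le>n. if prime p then 1 - ?h p else 1"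
  have lim: "(\<lambda>n. ?P n * zeta_real \<sigma>) \<longlonglongrightarrow> 1"
  proof (rule real_tendsto_sandwich)
    have eq: "?P n = (\<Prod>p\<in>{p. prime p \<and> p \<le> n}. 1 - ?h p)" for n
    proof (rule prod.mono_neutral_cong_right)
      show "{p. prime p \<and> p \<le> n} \<subseteq> {..n}" by blast
      show "\<forall>i\<in>{..n} - {p. prime p \<and> p \<le> n}. (if prime i then 1 - ?h i else 1) = 1" by auto
    qed simp_all
    have sieve: "(?h has_sum (?P n * zeta_real \<sigma>)) {k. \<forall>p. prime p \<and> p \<le> n \<longrightarrow> \<not> p dvd k}" for n
    proof -
      have "(?h has_sum ((\<Prod>p\<in>{p. prime p \<and> p \<le> n}. 1 - ?h p) * zeta_real \<sigma>))
          {k. \<forall>p\<in>{p. prime p \<and> p \<le> n}. \<not> p dvd k}"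
        by (rule has_sum_euler_sieve[OF assms]) auto
      thus ?thesis by (simp only: eq[symmetric] mem_Collect_eq Ball_def)
    qed
    have tail: "(?h has_sum (zeta_real \<sigma> - sum ?h {..n})) (UNIV - {..n})" for n
      by (intro has_sum_Diff has_sum_zeta_real assms has_sum_finite) auto
    show "\<forall>\<^sub>F n in sequentially. 1 \<le> ?P n * zeta_real \<sigma>"
    proof (intro always_eventually allI)
      fix n
      have "(?h has_sum 1) {1}" using has_sum_finite[of "{1::nat}" ?h] by simp
      thus "1 \<le> ?P n * zeta_real \<sigma>"
        by (rule has_sum_mono2[OF _ sieve]) auto
    qed
    show "\<forall>\<^sub>F n in sequentially. ?P n * zeta_real \<sigma> \<le> 1 + (zeta_real \<sigma> - sum ?h {..n})"
    proof (rule eventually_mono[OF eventually_ge_at_top[of 2]])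
      fix n :: nat assume n: "n \<ge> 2"
      have "(?h has_sum 1) {1}" using has_sum_finite[of "{1::nat}" ?h] by simp
      hence "(?h has_sum (1 + (zeta_real \<sigma> - sum ?h {..n}))) ({1} \<union> (UNIV - {..n}))"
        using n by (intro has_sum_Un_disjoint tail) auto
      moreover have "k \<in> {1} \<union> (UNIV - {..n})" if k: "\<forall>p. prime p \<and> p \<le> n \<longrightarrow> \<not> p dvd k" for k
      proof (rule ccontr)
        assume "k \<notin> {1} \<union> (UNIV - {..n})"
        hence "k \<noteq> 1" "k \<le> n" by auto
        show False
        proof (cases "k = 0")
          case True thus False using k n two_is_prime_nat by auto
        next
          case False
          obtain p where "prime p" "p dvd k" using prime_factor_nat[OF \<open>k \<noteq> 1\<close>] by blast
          moreover have "p \<le> n" using calculation \<open>k \<le> n\<close> False dvd_imp_le[of p k] by linarith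
          ultimately show False using k by blast
        qed
      qed
      ultimately show "?P n * zeta_real \<sigma> \<le> 1 + (zeta_real \<sigma> - sum ?h {..n})"
        by (intro has_sum_mono2[OF sieve]) auto
    qed
    have "(\<lambda>n. sum ?h {..n}) \<longlonglongrightarrow> zeta_real \<sigma>"
      using has_sum_imp_sums[OF has_sum_zeta_real[OF assms]] by (simp add: sums_def_le)
    hence "(\<lambda>n. 1 + (zeta_real \<sigma> - sum ?h {..n})) \<longlonglongrightarrow> 1 + (zeta_real \<sigma> - zeta_real \<sigma>)"
      by (intro tendsto_intros)
    thus "(\<lambda>n. 1 + (zeta_real \<sigma> - sum ?h {..n})) \<longlonglongrightarrow> 1" by simp
  qed auto
  have inv: "(\<Prod>p\<le>n. if prime p then 1 / (1 - ?h p) else 1) = 1 / ?P n" for n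
    by (subst prod.neutral_const[of "{..n}", symmetric], subst prod_dividef[symmetric])
       (rule prod.cong, auto)
  have nz: "zeta_real \<sigma> \<noteq> 0"
  proof
    assume "zeta_real \<sigma> = 0"
    with lim have "(\<lambda>n :: nat. 0 :: real) \<longlonglongrightarrow> 1" by simp
    thus False by (simp only: LIMSEQ_const_iff)
  qed
  have "(\<lambda>n. zeta_real \<sigma> / (?P n * zeta_real \<sigma>)) \<longlonglongrightarrow> zeta_real \<sigma> / 1"
    by (intro tendsto_divide tendsto_const lim) auto
  thus ?thesis unfolding inv using nz by simp
qed

lemma prime_powr_less_1: "prime p \<Longrightarrow> \<sigma> > 0 \<Longrightarrow> real p powr - \<sigma> < 1"
  using prime_gt_1_nat[of p] by (simp add: powr_less_one)

lemma one_le_euler_factor: "prime p \<Longrightarrow> \<sigma> > 0 \<Longrightarrow> 1 \<le> 1 / (1 - real p powr - \<sigma>)"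
  using prime_powr_less_1[of p \<sigma>] by simp

lemma euler_product_le_zeta_real:
  assumes "\<sigma> > 1"
  shows "(\<Prod>p\<le>n. if prime p then 1 / (1 - real p powr - \<sigma>) else 1) \<le> zeta_real \<sigma>"
proof (rule incseq_le[OF _ euler_product_zeta_real[OF assms]])
  show "incseq (\<lambda>n. \<Prod>p\<le>n. if prime p then 1 / (1 - real p powr - \<sigma>) else 1)"
  proof (rule incseq_SucI)
    fix n
    have nonneg: "0 \<le> (\<Prod>p\<le>n. if prime p then 1 / (1 - real p powr - \<sigma>) else 1)"
      using prime_powr_less_1[of _ \<sigma>] assms by (intro prod_nonneg) (simp add: less_imp_le)
    have "1 \<le> (if prime (Suc n) then 1 / (1 - real (Suc n) powr - \<sigma>) else 1)"
      using one_le_euler_factor[of "Suc n" \<sigma>] assms by simp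
    from mult_left_mono[OF this nonneg]
    show "(\<Prod>p\<le>n. if prime p then 1 / (1 - real p powr - \<sigma>) else 1)
        \<le> (\<Prod>p\<le>Suc n. if prime p then 1 / (1 - real p powr - \<sigma>) else 1)" by simp
  qed
qed

lemma zeta_real_ge_1:
  assumes "\<sigma> > 1"
  shows "zeta_real \<sigma> \<ge> 1"
  using euler_product_le_zeta_real[OF assms, of 0] by simp

lemma zeta_real_le:
  assumes "\<sigma> \<ge> 2"
  shows "zeta_real \<sigma> \<le> 1 + 2 powr (2 - \<sigma>) * zeta_real 2"
proof -
  have "((\<lambda>n. real n powr - \<sigma>) has_sum (zeta_real \<sigma> - sum (\<lambda>n. real n powr - \<sigma>) {..1})) (UNIV - {..1})"
    using assms by (intro has_sum_Diff has_sum_zeta_real has_sum_finite) auto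
  hence 1: "((\<lambda>n. real n powr - \<sigma>) has_sum (zeta_real \<sigma> - 1)) (UNIV - {..1})" by simp
  have 2: "((\<lambda>n. 2 powr (2 - \<sigma>) * (real n powr - 2)) has_sum (2 powr (2 - \<sigma>) * zeta_real 2)) UNIV"
    by (intro has_sum_cmult_right has_sum_zeta_real) auto
  have "zeta_real \<sigma> - 1 \<le> 2 powr (2 - \<sigma>) * zeta_real 2"
  proof (rule has_sum_mono_neutral[OF 1 2])
    fix n :: nat assume "n \<in> (UNIV - {..1}) \<inter> UNIV"
    hence n: "n \<ge> 2" by auto
    have "real n powr - \<sigma> = real n powr (2 - \<sigma>) * real n powr - 2"
      by (simp add: powr_add[symmetric])
    also have "\<dots> \<le> 2 powr (2 - \<sigma>) * (real n powr - 2)"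
      using n assms by (intro mult_right_mono powr_mono2') auto
    finally show "real n powr - \<sigma> \<le> 2 powr (2 - \<sigma>) * (real n powr - 2)" .
  qed auto
  thus ?thesis by simp
qed

lemma norm_mobius_le:
  fixes u :: complex
  assumes "norm u \<le> r" "r < 1" "0 \<le> q" "q \<le> 1"
  shows "norm ((1 - u * of_real q) / (1 - u)) \<le> (1 - r * q) / (1 - r)"
proof -
  have u1: "u \<noteq> 1" using assms by auto
  have "(1 - u * of_real q) / (1 - u) = of_real q + of_real (1 - q) / (1 - u)"
    using u1 by (simp add: field_simps)
  also have "norm \<dots> \<le> norm (of_real q :: complex) + norm (of_real (1 - q) / (1 - u))"
    by (rule norm_triangle_ineq)
  also have "\<dots> = q + (1 - q) / norm (1 - u)"
    unfolding norm_divide norm_of_real using assms by simp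
  also have "\<dots> \<le> q + (1 - q) / (1 - r)"
  proof (intro add_left_mono divide_left_mono mult_pos_pos)
    have "1 - r \<le> norm (1 - u)" using assms norm_triangle_ineq2[of 1 u] by simp
    thus "1 - r \<le> norm (1 - u)" "norm (1 - u) > 0" using assms by auto
  qed (use assms in auto)
  also have "\<dots> = (1 - r * q) / (1 - r)" using assms by (simp add: field_simps)
  finally show ?thesis .
qed

lemma poly_factor_at_0:
  fixes Q :: "complex poly"
  assumes "coeff Q 0 = 1" "degree Q \<le> d" "c > 0" and roots: "\<And>x. poly Q x = 0 \<Longrightarrow> norm x \<ge> c"
  shows "\<exists>\<beta>. (\<forall>i. norm (\<beta> i) \<le> 1 / c) \<and> (\<forall>y. poly Q y = (\<Prod>i<d. 1 - \<beta> i * y))"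
proof -
  obtain r :: "nat \<Rightarrow> complex" where r: "smult (lead_coeff Q) (\<Prod>i<degree Q. [:-r i, 1:]) = Q"
    using complex_poly_decompose'[of Q] by blast
  have pr: "poly Q x = lead_coeff Q * (\<Prod>i<degree Q. x - r i)" for x
    using arg_cong[OF r, of "\<lambda>q. poly q x"] by (simp add: poly_prod)
  have rc: "norm (r i) \<ge> c" if "i < degree Q" for i
  proof (rule roots)
    show "poly Q (r i) = 0" using that by (subst pr) auto
  qed
  hence r0: "r i \<noteq> 0" if "i < degree Q" for i using that \<open>c > 0\<close> by force
  define \<beta> where "\<beta> i = (if i < degree Q then 1 / r i else 0)" for i
  show ?thesis
  proof (intro exI[of _ \<beta>] conjI allI)
    show "norm (\<beta> i) \<le> 1 / c" for i
      using rc[of i] \<open>c > 0\<close> by (auto simp: \<beta>_def norm_divide intro!: divide_left_mono mult_pos_pos intro: less_le_trans)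
    fix y
    have "1 = poly Q 0" using assms by (simp add: poly_0_coeff_0)
    hence one: "1 = lead_coeff Q * (\<Prod>i<degree Q. - r i)" by (subst (asm) pr) simp
    have "poly Q y = lead_coeff Q * (\<Prod>i<degree Q. - r i * (1 - \<beta> i * y))"
      unfolding pr using r0 by (intro arg_cong2[of _ _ _ _ "(*)"] prod.cong) (auto simp: \<beta>_def field_simps)
    also have "\<dots> = (\<Prod>i<degree Q. 1 - \<beta> i * y)"
      unfolding prod.distrib mult.assoc[symmetric] one[symmetric] by simp
    also have "\<dots> = (\<Prod>i<d. 1 - \<beta> i * y)"
      using assms by (intro prod.mono_neutral_left) (auto simp: \<beta>_def)
    finally show "poly Q y = (\<Prod>i<d. 1 - \<beta> i * y)" .
  qed
qed

definition L_factor :: "motive \<Rightarrow> complex \<Rightarrow> nat \<Rightarrow> complex" where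
  "L_factor M s p = (if prime p then 1 / poly (frob_poly M p) (of_nat p powr (- s)) else 1)"

definition zeta_factor :: "real \<Rightarrow> nat \<Rightarrow> real" where
  "zeta_factor \<sigma> p = (if prime p then 1 / (1 - real p powr - \<sigma>) else 1)"

lemma zeta_factor_ge_1: "\<sigma> > 0 \<Longrightarrow> 1 \<le> zeta_factor \<sigma> p"
  using one_le_euler_factor[of p \<sigma>] by (auto simp: zeta_factor_def)

lemma zeta_factor_LIMSEQ: "\<sigma> > 1 \<Longrightarrow> (\<lambda>n. \<Prod>p\<le>n. zeta_factor \<sigma> p) \<longlonglongrightarrow> zeta_real \<sigma>"
  using euler_product_zeta_real[of \<sigma>] by (simp add: zeta_factor_def[abs_def])

lemma prod_zeta_factor_le: "\<sigma> > 1 \<Longrightarrow> (\<Prod>p\<le>n. zeta_factor \<sigma> p) \<le> zeta_real \<sigma>"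
  using euler_product_le_zeta_real[of \<sigma>] by (simp add: zeta_factor_def[abs_def])

locale automorphic =
  fixes M :: motive
  assumes automorphic: "automorphic_motive M"
begin

lemma
  shows rank_eq: "rank M = 2 * (\<Sum>\<nu>=0..half_wt M. hodge M \<nu>)"
    and conductor_ge_1: "conductor M \<ge> 1"
    and frob_poly: "\<forall>p. prime p \<longrightarrow>
        coeff (frob_poly M p) 0 = 1 \<and>
        degree (frob_poly M p) \<le> rank M \<and>
        (\<forall>x. poly (frob_poly M p) x = 0 \<longrightarrow> norm x \<ge> real p powr (- (real (weight M) / 2))) \<and>
        (\<not> p dvd conductor M \<longrightarrow>
           degree (frob_poly M p) = rank M \<and>
           (\<forall>x. poly (frob_poly M p) x = 0 \<longrightarrow> norm x = real p powr (- (real (weight M) / 2))))"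
    and dirichlet_series: "\<forall>s. Re s > real (weight M) / 2 + 1 \<longrightarrow>
        summable (\<lambda>n. norm (dcoeff M (Suc n) * of_nat (Suc n) powr (- s))) \<and>
        (\<lambda>n. dcoeff M (Suc n) * of_nat (Suc n) powr (- s)) sums motive_L M s"
    and dcoeff: "\<forall>n\<ge>1. dcoeff M n \<in> \<real> \<and>
        norm (dcoeff M n) \<le> real (divisor_fun (rank M) n) * real n powr (real (weight M) / 2)"
    and completed_L_holomorphic: "completed_L M holomorphic_on UNIV"
    and growth_order_completed_L: "growth_order (completed_L M) = 1"
    and completed_L_eq: "\<forall>s. Re s > real (weight M) / 2 + 1 \<longrightarrow>
        completed_L M s = of_nat (conductor M) powr (s / 2) * L_infty M s * motive_L M s"
    and functional_equation:
      "\<exists>\<epsilon>\<in>{1, -1}. \<forall>s. completed_L M s = \<epsilon> * completed_L M (of_nat (weight M) + 1 - s)"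
    and central_value: "completed_L M ((of_nat (weight M) + 1) / 2) \<in> \<real>\<^sub>\<ge>\<^sub>0"
  by (insert automorphic[unfolded automorphic_motive_def]) (elim conjE, assumption)+

lemma frob_poly_factors:
  assumes "prime p"
  shows "\<exists>\<beta>. (\<forall>i. norm (\<beta> i) \<le> real p powr (weight M / 2)) \<and>
    (\<forall>y. poly (frob_poly M p) y = (\<Prod>i<rank M. 1 - \<beta> i * y))"
proof -
  have p: "real p > 0" using prime_gt_0_nat[OF assms] by simp
  have *: "coeff (frob_poly M p) 0 = 1" "degree (frob_poly M p) \<le> rank M"
    "\<And>x. poly (frob_poly M p) x = 0 \<Longrightarrow> norm x \<ge> real p powr (- (weight M / 2))"
    using frob_poly assms by blast+
  have c0: "real p powr (- (weight M / 2)) > 0" using p by simp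
  have "1 / real p powr (- (weight M / 2)) = real p powr (weight M / 2)"
    by (simp add: powr_minus_divide)
  with poly_factor_at_0[OF *(1,2) c0 *(3)] show ?thesis by (simp only:)
qed

lemma L_factor_eq:
  assumes "prime p" "Re s > weight M / 2"
  shows "\<exists>u. (\<forall>i. norm (u i) \<le> real p powr - (Re s - weight M / 2)) \<and>
    (\<forall>t :: real. L_factor M (s + of_real t) p = (\<Prod>i<rank M. 1 / (1 - u i * of_real (real p powr - t))))"
proof -
  have p: "real p > 0" using prime_gt_0_nat[OF assms(1)] by simp
  obtain \<beta> where \<beta>: "\<And>i. norm (\<beta> i) \<le> real p powr (weight M / 2)"
    "\<And>y. poly (frob_poly M p) y = (\<Prod>i<rank M. 1 - \<beta> i * y)"
    using frob_poly_factors[OF assms(1)] by blast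
  show ?thesis
  proof (intro exI[of _ "\<lambda>i. \<beta> i * of_nat p powr - s"] conjI allI)
    fix i
    have "norm (\<beta> i * of_nat p powr - s) \<le> real p powr (weight M / 2) * real p powr - Re s"
      unfolding norm_mult using \<beta>(1)[of i] by (intro mult_mono) (auto simp: norm_powr_real_powr)
    also have "\<dots> = real p powr - (Re s - weight M / 2)" by (simp add: powr_add[symmetric])
    finally show "norm (\<beta> i * of_nat p powr - s) \<le> real p powr - (Re s - weight M / 2)" .
  next
    fix t :: real
    have "(of_nat p :: complex) powr - (s + of_real t) = of_nat p powr - s * of_real (real p powr - t)"
    proof -
      have "- (s + of_real t) = - s + of_real (- t)" by simp
      hence "(of_nat p :: complex) powr - (s + of_real t) = of_nat p powr - s * of_real (real p) powr of_real (- t)"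
        by (simp only: powr_add of_real_of_nat_eq)
      also have "(of_real (real p) :: complex) powr of_real (- t) = of_real (real p powr - t)"
        using p by (intro powr_of_real) auto
      finally show ?thesis .
    qed
    thus "L_factor M (s + of_real t) p = (\<Prod>i<rank M. 1 / (1 - \<beta> i * of_nat p powr - s * of_real (real p powr - t)))"
      using assms by (simp only: L_factor_def \<beta>(2) prod_dividef prod.neutral_const mult.assoc if_True)
  qed
qed

lemma norm_L_factor_minus_1_le:
  assumes "Re s > weight M / 2"
  shows "norm (L_factor M s p - 1) \<le> zeta_factor (Re s - weight M / 2) p ^ rank M - 1"
proof (cases "prime p")
  case True
  define r where "r = real p powr - (Re s - weight M / 2)"
  have r1: "r < 1" unfolding r_def using assms True by (intro prime_powr_less_1) auto
  obtain u where u: "\<And>i. norm (u i) \<le> r"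
    "\<And>t :: real. L_factor M (s + of_real t) p = (\<Prod>i<rank M. 1 / (1 - u i * of_real (real p powr - t)))"
    using L_factor_eq[OF True assms, folded r_def] by blast
  have "L_factor M s p = (\<Prod>i<rank M. 1 + (1 / (1 - u i) - 1))"
    using u(2)[of 0] True prime_gt_0_nat[OF True] by simp
  also have "norm (\<dots> - 1) \<le> (\<Prod>i<rank M. 1 + norm (1 / (1 - u i) - 1)) - 1"
    by (rule norm_prod_minus1_le_prod_minus1)
  also have "\<dots> \<le> (\<Prod>i<rank M. 1 / (1 - r)) - 1"
  proof (intro diff_right_mono prod_mono conjI)
    fix i
    have u1: "norm (u i) < 1" using u(1)[of i] r1 by simp
    have le: "1 - r \<le> norm (1 - u i)" using u(1)[of i] norm_triangle_ineq2[of 1 "u i"] by simp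
    have "1 / (1 - u i) - 1 = u i / (1 - u i)" using u1 by (cases "u i = 1") (auto simp: divide_simps)
    also have "norm \<dots> \<le> r / (1 - r)"
      unfolding norm_divide using u(1)[of i] le r1 by (intro frac_le) (auto intro: order_trans[OF norm_ge_zero])
    finally show "1 + norm (1 / (1 - u i) - 1) \<le> 1 / (1 - r)" using r1 by (simp add: field_simps)
  qed auto
  also have "\<dots> = zeta_factor (Re s - weight M / 2) p ^ rank M - 1"
    using True by (simp add: zeta_factor_def r_def)
  finally show ?thesis .
qed (auto simp: L_factor_def zeta_factor_def)

lemma L_factor_nonzero:
  assumes "Re s > weight M / 2"
  shows "L_factor M s p \<noteq> 0"
proof (cases "prime p")
  case True
  obtain u where u: "\<And>i. norm (u i) \<le> real p powr - (Re s - weight M / 2)"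
    "\<And>t :: real. L_factor M (s + of_real t) p = (\<Prod>i<rank M. 1 / (1 - u i * of_real (real p powr - t)))"
    using L_factor_eq[OF True assms] by blast
  have "u i \<noteq> 1" for i using u(1)[of i] prime_powr_less_1[OF True, of "Re s - weight M / 2"] assms by auto
  thus ?thesis using u(2)[of 0] True prime_gt_0_nat[OF True] by auto
qed (auto simp: L_factor_def)

lemma norm_prod_L_factor_minus_1_le:
  assumes "Re s > weight M / 2 + 1"
  shows "norm ((\<Prod>p\<le>n. L_factor M s p) - 1) \<le> zeta_real (Re s - weight M / 2) ^ rank M - 1"
    and "(\<Sum>p\<le>n. norm (L_factor M s p - 1)) \<le> zeta_real (Re s - weight M / 2) ^ rank M"
proof -
  have "(\<Prod>p\<le>n. 1 + norm (L_factor M s p - 1)) \<le> (\<Prod>p\<le>n. zeta_factor (Re s - weight M / 2) p ^ rank M)"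
    using norm_L_factor_minus_1_le[of s] assms by (intro prod_mono) (auto simp: algebra_simps)
  also have "\<dots> = (\<Prod>p\<le>n. zeta_factor (Re s - weight M / 2) p) ^ rank M" by (rule prod_power_distrib[symmetric])
  also have "\<dots> \<le> zeta_real (Re s - weight M / 2) ^ rank M"
    using assms zeta_factor_ge_1[of "Re s - weight M / 2"]
    by (intro power_mono prod_zeta_factor_le prod_nonneg) (auto intro: order_trans[OF zero_le_one])
  finally have *: "(\<Prod>p\<le>n. 1 + norm (L_factor M s p - 1)) \<le> zeta_real (Re s - weight M / 2) ^ rank M" .
  from norm_prod_minus1_le_prod_minus1[of "\<lambda>p. L_factor M s p - 1" "{..n}"] *
  show "norm ((\<Prod>p\<le>n. L_factor M s p) - 1) \<le> zeta_real (Re s - weight M / 2) ^ rank M - 1" by simp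
  have "(\<Sum>p\<le>n. norm (L_factor M s p - 1)) \<le> (\<Prod>p\<le>n. 1 + norm (L_factor M s p - 1))"
    by (rule sum_le_prod) auto
  with * show "(\<Sum>p\<le>n. norm (L_factor M s p - 1)) \<le> zeta_real (Re s - weight M / 2) ^ rank M" by simp
qed

lemma L_factor_convergent:
  assumes "Re s > weight M / 2 + 1"
  shows "convergent_prod (L_factor M s)"
proof -
  have "summable (\<lambda>p. norm (L_factor M s p - 1))"
  proof (rule summableI_nonneg_bounded)
    fix n
    have "(\<Sum>p<n. norm (L_factor M s p - 1)) \<le> (\<Sum>p\<le>n. norm (L_factor M s p - 1))"
      by (rule sum_mono2) auto
    thus "(\<Sum>p<n. norm (L_factor M s p - 1)) \<le> zeta_real (Re s - weight M / 2) ^ rank M"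
      using norm_prod_L_factor_minus_1_le(2)[OF assms] by (rule order_trans)
  qed auto
  hence "abs_convergent_prod (L_factor M s)" by (rule summable_imp_abs_convergent_prod)
  thus ?thesis by (rule abs_convergent_prod_imp_convergent_prod)
qed

lemma motive_L_eq: "motive_L M s = prodinf (L_factor M s)"
  by (simp add: motive_L_def L_factor_def[abs_def])

lemma motive_L_LIMSEQ:
  assumes "Re s > weight M / 2 + 1"
  shows "(\<lambda>n. \<Prod>p\<le>n. L_factor M s p) \<longlonglongrightarrow> motive_L M s"
  unfolding motive_L_eq using convergent_prod_LIMSEQ[OF L_factor_convergent[OF assms]] .

lemma motive_L_nonzero:
  assumes "Re s > weight M / 2 + 1"
  shows "motive_L M s \<noteq> 0"
  unfolding motive_L_eq
  using L_factor_convergent[OF assms] L_factor_nonzero[of s] assms by (intro prodinf_nonzero) auto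

lemma norm_motive_L_minus_1_le:
  assumes "Re s > weight M / 2 + 1"
  shows "norm (motive_L M s - 1) \<le> zeta_real (Re s - weight M / 2) ^ rank M - 1"
proof (rule LIMSEQ_le_const2)
  show "(\<lambda>n. norm ((\<Prod>p\<le>n. L_factor M s p) - 1)) \<longlonglongrightarrow> norm (motive_L M s - 1)"
    by (rule tendsto_norm[OF tendsto_diff[OF motive_L_LIMSEQ[OF assms] tendsto_const]])
qed (use norm_prod_L_factor_minus_1_le(1)[OF assms] in blast)

lemma norm_motive_L_le_shift:
  assumes s: "Re s > weight M / 2 + 1" and t: "t \<ge> 0"
  shows "norm (motive_L M s) \<le>
    (zeta_real (Re s - weight M / 2) / zeta_real (Re s - weight M / 2 + t)) ^ rank M * norm (motive_L M (s + of_real t))"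
proof -
  define \<sigma> where "\<sigma> = Re s - weight M / 2"
  have \<sigma>: "\<sigma> > 1" using s by (simp add: \<sigma>_def)
  have s2: "Re s > weight M / 2" using s by simp
  have s': "Re (s + of_real t) > weight M / 2 + 1" using s t by simp
  have factor: "norm (L_factor M s p) \<le> (zeta_factor \<sigma> p / zeta_factor (\<sigma> + t) p) ^ rank M * norm (L_factor M (s + of_real t) p)" for p
  proof (cases "prime p")
    case True
    define r where "r = real p powr - \<sigma>"
    define q where "q = real p powr - t"
    have r1: "r < 1" unfolding r_def using \<sigma> True by (intro prime_powr_less_1) auto
    have p1: "real p > 1" using prime_gt_1_nat[OF True] by simp
    have q1: "q \<le> 1" "q \<ge> 0" unfolding q_def using p1 t powr_mono[of "-t" 0 "real p"] by auto
    obtain u where u: "\<And>i. norm (u i) \<le> r"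
      "\<And>t :: real. L_factor M (s + of_real t) p = (\<Prod>i<rank M. 1 / (1 - u i * of_real (real p powr - t)))"
      using L_factor_eq[OF True s2, folded \<sigma>_def r_def] by blast
    have u1: "1 - u i * of_real q \<noteq> 0" for i
    proof -
      have "norm (u i * of_real q) \<le> r * 1"
        unfolding norm_mult using u(1)[of i] q1 by (intro mult_mono) (auto intro: order_trans[OF norm_ge_zero])
      thus ?thesis using r1 by auto
    qed
    have "L_factor M s p = (\<Prod>i<rank M. 1 / (1 - u i))"
      using u(2)[of 0] True prime_gt_0_nat[OF True] by simp
    also have "\<dots> = (\<Prod>i<rank M. (1 - u i * of_real q) / (1 - u i)) * L_factor M (s + of_real t) p"
      unfolding u(2) prod.distrib[symmetric] q_def[symmetric] using u1 by (intro prod.cong) auto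
    also have "norm \<dots> \<le> (\<Prod>i<rank M. (1 - r * q) / (1 - r)) * norm (L_factor M (s + of_real t) p)"
      unfolding norm_mult prod_norm[symmetric] using u(1) r1 q1
      by (intro mult_right_mono prod_mono conjI norm_mobius_le) auto
    also have "r * q = real p powr - (\<sigma> + t)" unfolding r_def q_def by (simp add: powr_add[symmetric])
    finally show ?thesis using True by (simp add: zeta_factor_def r_def)
  qed (auto simp: L_factor_def zeta_factor_def)
  have "norm (\<Prod>p\<le>n. L_factor M s p) \<le>
      ((\<Prod>p\<le>n. zeta_factor \<sigma> p) / (\<Prod>p\<le>n. zeta_factor (\<sigma> + t) p)) ^ rank M * norm (\<Prod>p\<le>n. L_factor M (s + of_real t) p)" for n
  proof -
    have "norm (\<Prod>p\<le>n. L_factor M s p) = (\<Prod>p\<le>n. norm (L_factor M s p))" by (rule prod_norm[symmetric])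
    also have "\<dots> \<le> (\<Prod>p\<le>n. (zeta_factor \<sigma> p / zeta_factor (\<sigma> + t) p) ^ rank M * norm (L_factor M (s + of_real t) p))"
      using factor by (intro prod_mono) auto
    also have "\<dots> = (\<Prod>p\<le>n. zeta_factor \<sigma> p / zeta_factor (\<sigma> + t) p) ^ rank M * (\<Prod>p\<le>n. norm (L_factor M (s + of_real t) p))"
      by (simp only: prod.distrib prod_power_distrib)
    finally show ?thesis by (simp only: prod_dividef prod_norm)
  qed
  moreover have "(\<lambda>n. norm (\<Prod>p\<le>n. L_factor M s p)) \<longlonglongrightarrow> norm (motive_L M s)"
    by (rule tendsto_norm[OF motive_L_LIMSEQ[OF s]])
  moreover have "(\<lambda>n. ((\<Prod>p\<le>n. zeta_factor \<sigma> p) / (\<Prod>p\<le>n. zeta_factor (\<sigma> + t) p)) ^ rank M * norm (\<Prod>p\<le>n. L_factor M (s + of_real t) p))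
      \<longlonglongrightarrow> (zeta_real \<sigma> / zeta_real (\<sigma> + t)) ^ rank M * norm (motive_L M (s + of_real t))"
  proof (rule tendsto_mult[OF tendsto_power[OF tendsto_divide] tendsto_norm[OF motive_L_LIMSEQ[OF s']]],
         rule zeta_factor_LIMSEQ[of \<sigma>], goal_cases)
    case 2
    show ?case using \<sigma> t by (intro zeta_factor_LIMSEQ) auto
  next
    case 3
    show ?case using \<sigma> t zeta_real_ge_1[of "\<sigma> + t"] by linarith
  qed (rule \<sigma>)
  ultimately show ?thesis unfolding \<sigma>_def[symmetric] by (meson LIMSEQ_le)
qed

end

section \<open>The completed L-function\<close>

definition Gamma_C_real :: "real \<Rightarrow> real" where
  "Gamma_C_real x = 2 * (2 * pi) powr - x * Gamma x"

lemma Gamma_C_of_real: "x > 0 \<Longrightarrow> Gamma_C (of_real x) = of_real (Gamma_C_real x)"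
  using powr_of_real[of "2 * pi" "- x"]
  by (simp add: Gamma_C_def Gamma_C_real_def Gamma_complex_of_real)

lemma Gamma_C_real_pos: "x > 0 \<Longrightarrow> Gamma_C_real x > 0"
  by (simp add: Gamma_C_real_def Gamma_real_pos)

lemma Gamma_C_real_plus_1: "x > 0 \<Longrightarrow> Gamma_C_real (x + 1) = x / (2 * pi) * Gamma_C_real x"
proof -
  assume "x > 0"
  hence "Gamma (x + 1) = x * Gamma x" using Gamma_plus1[of x] nonpos_Ints_nonpos[of x] by auto
  moreover have "(2 * pi) powr - (x + 1) = (2 * pi) powr - x / (2 * pi)"
    using powr_add[of "2 * pi" "- x" "- 1"] by (simp add: powr_minus_divide)
  ultimately show ?thesis by (simp add: Gamma_C_real_def)
qed

lemma Gamma_C_nonzero: "Re s > 0 \<Longrightarrow> Gamma_C s \<noteq> 0"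
  using nonpos_Ints_nonpos by (auto simp: Gamma_C_def Gamma_eq_zero_iff elim!: nonpos_Ints_cases)

lemma zeta_real_tendsto_1: "(zeta_real \<longlongrightarrow> 1) at_top"
proof (rule tendsto_sandwich)
  show "\<forall>\<^sub>F \<sigma> in at_top. 1 \<le> zeta_real \<sigma>"
    using eventually_gt_at_top[of 1] by eventually_elim (rule zeta_real_ge_1)
  show "\<forall>\<^sub>F \<sigma> in at_top. zeta_real \<sigma> \<le> 1 + 2 powr (2 - \<sigma>) * zeta_real 2"
    using eventually_ge_at_top[of 2] by eventually_elim (rule zeta_real_le)
  have "((\<lambda>\<sigma>. 2 powr (2 - \<sigma>)) \<longlongrightarrow> (0 :: real)) at_top" by real_asymp
  hence "((\<lambda>\<sigma>. 1 + 2 powr (2 - \<sigma>) * zeta_real 2) \<longlongrightarrow> 1 + 0 * zeta_real 2) at_top"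
    by (intro tendsto_intros)
  thus "((\<lambda>\<sigma>. 1 + 2 powr (2 - \<sigma>) * zeta_real 2) \<longlongrightarrow> 1) at_top" by simp
qed auto

context automorphic
begin

abbreviation "m \<equiv> half_wt M"

definition L_inf_real :: "real \<Rightarrow> real" where
  "L_inf_real x = (\<Prod>\<nu>=0..m. Gamma_C_real (x - real \<nu>) ^ hodge M \<nu>)"

definition L_real :: "real \<Rightarrow> real" where
  "L_real x = Re (motive_L M (of_real x))"

definition Lambda :: "real \<Rightarrow> real" where
  "Lambda x = Re (completed_L M (of_real x))"

lemma weight_half: "real (weight M) / 2 = real m + 1 / 2"
  by (simp add: weight_def field_simps)

lemma L_infty_of_real:
  assumes "x > real m"
  shows "L_infty M (of_real x) = of_real (L_inf_real x)"
proof -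
  have "Gamma_C (of_real x - of_nat \<nu>) = of_real (Gamma_C_real (x - real \<nu>))" if "\<nu> \<in> {0..m}" for \<nu>
    using Gamma_C_of_real[of "x - real \<nu>"] assms that by simp
  thus ?thesis unfolding L_infty_def L_inf_real_def of_real_prod of_real_power
    by (intro prod.cong) auto
qed

lemma L_inf_real_pos:
  assumes "x > real m"
  shows "L_inf_real x > 0"
  unfolding L_inf_real_def using assms by (intro prod_pos ballI zero_less_power Gamma_C_real_pos) auto

lemma L_infty_nonzero:
  assumes "Re s > real m"
  shows "L_infty M s \<noteq> 0"
  unfolding L_infty_def using assms Gamma_C_nonzero by (auto simp: prod_zero_iff)

lemma motive_L_of_real:
  assumes "x > real m + 3 / 2"
  shows "motive_L M (of_real x) = of_real (L_real x)"
proof -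
  have "(\<lambda>n. dcoeff M (Suc n) * of_nat (Suc n) powr (- of_real x)) sums motive_L M (of_real x)"
    using dirichlet_series assms weight_half by simp
  from sums_Im[OF this] have "(\<lambda>n. Im (dcoeff M (Suc n) * of_nat (Suc n) powr (- of_real x))) sums Im (motive_L M (of_real x))" .
  moreover have "Im (dcoeff M (Suc n) * of_nat (Suc n) powr (- of_real x)) = 0" for n
  proof -
    have "(of_nat (Suc n) :: complex) powr (- of_real x) = of_real (real (Suc n) powr - x)"
      using powr_of_real[of "real (Suc n)" "- x"] by simp
    moreover have "dcoeff M (Suc n) \<in> \<real>" using dcoeff by simp
    ultimately have "dcoeff M (Suc n) * of_nat (Suc n) powr (- of_real x) \<in> \<real>" by (metis Reals_mult Reals_of_real)
    thus ?thesis by (simp add: complex_is_Real_iff)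
  qed
  ultimately have "(\<lambda>_ :: nat. 0) sums Im (motive_L M (of_real x))" by (simp only:)
  hence "Im (motive_L M (of_real x)) = 0" using sums_unique2 sums_zero by blast
  thus ?thesis by (simp add: L_real_def complex_eq_iff)
qed

lemma completed_L_of_real:
  assumes "x > real m + 3 / 2"
  shows "completed_L M (of_real x) = of_real (Lambda x)"
    and "Lambda x = real (conductor M) powr (x / 2) * L_inf_real x * L_real x"
proof -
  have "completed_L M (of_real x) = of_nat (conductor M) powr (of_real x / 2) * L_infty M (of_real x) * motive_L M (of_real x)"
    using completed_L_eq assms weight_half by simp
  also have "(of_nat (conductor M) :: complex) powr (of_real x / 2) = of_real (real (conductor M) powr (x / 2))"
    using powr_of_real[of "real (conductor M)" "x / 2"] by simp
  also have "L_infty M (of_real x) = of_real (L_inf_real x)"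
    using assms by (intro L_infty_of_real) auto
  also have "motive_L M (of_real x) = of_real (L_real x)" by (rule motive_L_of_real[OF assms])
  finally have *: "completed_L M (of_real x) = of_real (real (conductor M) powr (x / 2) * L_inf_real x * L_real x)"
    by simp
  show "Lambda x = real (conductor M) powr (x / 2) * L_inf_real x * L_real x"
    unfolding Lambda_def * by simp
  with * show "completed_L M (of_real x) = of_real (Lambda x)" by simp
qed

lemma completed_L_nonzero:
  assumes "Re s > real m + 3 / 2"
  shows "completed_L M s \<noteq> 0"
proof -
  have "completed_L M s = of_nat (conductor M) powr (s / 2) * L_infty M s * motive_L M s"
    using completed_L_eq assms weight_half by simp
  moreover have "motive_L M s \<noteq> 0" using assms by (intro motive_L_nonzero) (simp add: weight_def field_simps)
  moreover have "L_infty M s \<noteq> 0" using assms by (intro L_infty_nonzero) simp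
  ultimately show ?thesis using conductor_ge_1 by simp
qed

lemma L_real_pos:
  assumes x: "x > real m + 3 / 2"
  shows "L_real x > 0"
proof (rule ccontr)
  assume "\<not> L_real x > 0"
  hence x_neg: "Lambda x \<le> 0"
    unfolding completed_L_of_real(2)[OF x] using L_inf_real_pos[of x] x by (intro mult_nonneg_nonpos) auto
  have "((\<lambda>\<sigma>. zeta_real \<sigma> ^ rank M) \<longlongrightarrow> 1 ^ rank M) at_top"
    by (intro tendsto_intros zeta_real_tendsto_1)
  hence "\<forall>\<^sub>F \<sigma> in at_top. zeta_real \<sigma> ^ rank M < 2" by (rule order_tendstoD(2)) simp
  with eventually_ge_at_top[of x] have "\<forall>\<^sub>F \<sigma> in at_top. zeta_real \<sigma> ^ rank M < 2 \<and> x \<le> \<sigma>"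
    by eventually_elim auto
  then obtain \<sigma> where \<sigma>: "zeta_real \<sigma> ^ rank M < 2" "x \<le> \<sigma>"
    using eventually_happens[of _ at_top] by force
  define y where "y = \<sigma> + real m + 1 / 2"
  have y: "y > real m + 3 / 2" "x \<le> y" using \<sigma> x by (auto simp: y_def)
  have "norm (motive_L M (of_real y) - 1) \<le> zeta_real \<sigma> ^ rank M - 1"
    using norm_motive_L_minus_1_le[of "of_real y"] y(1) weight_half by (simp add: y_def)
  hence "norm (motive_L M (of_real y) - 1) < 1" using \<sigma> by simp
  hence "L_real y > 0"
    using abs_Re_le_cmod[of "motive_L M (of_real y) - 1"] by (simp add: L_real_def)
  hence y_pos: "Lambda y \<ge> 0"
    unfolding completed_L_of_real(2)[OF y(1)] using L_inf_real_pos[of y] y by (intro mult_nonneg_nonneg) auto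
  have "continuous_on UNIV (\<lambda>x. completed_L M (of_real x))"
    by (intro continuous_on_compose2[OF holomorphic_on_imp_continuous_on[OF completed_L_holomorphic]] continuous_intros) auto
  hence "continuous_on {x..y} Lambda"
    unfolding Lambda_def by (intro continuous_intros) (rule continuous_on_subset, auto)
  then obtain z where z: "x \<le> z" "z \<le> y" "Lambda z = 0"
    using IVT'[of Lambda x 0 y] x_neg y_pos y(2) by blast
  have "completed_L M (of_real z) = 0" using completed_L_of_real(1)[of z] z x by simp
  thus False using completed_L_nonzero[of "of_real z"] z x by simp
qed

lemma Lambda_pos: "x > real m + 3 / 2 \<Longrightarrow> Lambda x > 0"
  using completed_L_of_real(2)[of x] L_real_pos[of x] L_inf_real_pos[of x] conductor_ge_1
  by (auto intro!: mult_pos_pos)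

lemma completed_L_zero_Re:
  assumes "completed_L M s = 0"
  shows "\<bar>Re s - (real m + 1)\<bar> \<le> 1 / 2"
proof -
  have "Re s \<le> real m + 3 / 2" using completed_L_nonzero[of s] assms by force
  moreover have "completed_L M (of_nat (weight M) + 1 - s) = 0"
    using functional_equation assms by (metis mult_eq_0_iff insertE singletonD zero_neq_neg_one zero_neq_one)
  hence "Re (of_nat (weight M) + 1 - s) \<le> real m + 3 / 2"
    using completed_L_nonzero[of "of_nat (weight M) + 1 - s"] by force
  hence "Re s \<ge> real m + 1 / 2" by (simp add: weight_def)
  ultimately show ?thesis unfolding abs_le_iff by linarith
qed

lemma completed_L_growth:
  "\<exists>R a C. 0 \<le> a \<and> a < 2 \<and> (\<forall>z. norm z \<ge> R \<longrightarrow> norm (completed_L M z) \<le> C * exp (norm z powr a))"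
proof -
  have "Inf (ereal ` {a. 0 \<le> a \<and> (\<lambda>z. norm (completed_L M z)) \<in> O[at_infinity](\<lambda>z. exp (norm z powr a))}) < 2"
    using growth_order_completed_L unfolding growth_order_def by simp
  then obtain a where a: "0 \<le> a" "ereal a < 2" "(\<lambda>z. norm (completed_L M z)) \<in> O[at_infinity](\<lambda>z. exp (norm z powr a))"
    unfolding Inf_less_iff by blast
  obtain C where "\<forall>\<^sub>F z in at_infinity. norm (norm (completed_L M z)) \<le> C * norm (exp (norm z powr a))"
    using landau_o.bigE[OF a(3)] by blast
  then obtain R where "\<forall>z. norm z \<ge> R \<longrightarrow> norm (completed_L M z) \<le> C * exp (norm z powr a)"
    unfolding eventually_at_infinity by auto
  moreover have "a < 2" using a(2) by simp
  ultimately show ?thesis using a(1) by blast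
qed

lemma Lambda_center_nonneg: "completed_L M (of_nat (m + 1)) = of_real (Lambda (real m + 1))" "Lambda (real m + 1) \<ge> 0"
proof -
  have "(of_nat (weight M) + 1) / 2 = (of_nat (m + 1) :: complex)" by (simp add: weight_def field_simps)
  hence *: "completed_L M (of_nat (m + 1)) \<in> \<real>\<^sub>\<ge>\<^sub>0" using central_value by (simp only:)
  hence "completed_L M (of_real (real m + 1)) \<in> \<real>\<^sub>\<ge>\<^sub>0" by (simp add: add.commute)
  thus "Lambda (real m + 1) \<ge> 0" unfolding Lambda_def using complex_nonneg_Reals_iff by blast
  show "completed_L M (of_nat (m + 1)) = of_real (Lambda (real m + 1))"
    unfolding Lambda_def using * by (simp add: complex_nonneg_Reals_iff complex_eq_iff add.commute)
qed

lemma Lambda_center_le: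
  assumes x: "x > 0" "x\<^sup>2 \<ge> 1 / 2"
  shows "Lambda (real m + 1) \<le> Lambda (real m + 1 + x)"
proof -
  have x2: "x > 1 / 2"
  proof (rule ccontr)
    assume "\<not> x > 1 / 2"
    hence "x\<^sup>2 \<le> (1 / 2)\<^sup>2" using x by (intro power_mono) auto
    thus False using x by (simp add: power2_eq_square)
  qed
  define F where "F z = completed_L M (of_nat (m + 1) + z)" for z
  obtain R a C where g: "0 \<le> a" "a < 2" "\<And>z. norm z \<ge> R \<Longrightarrow> norm (completed_L M z) \<le> C * exp (norm z powr a)"
    using completed_L_growth by blast
  have "(norm (F 0))\<^sup>2 \<le> norm (F (of_real x)) * norm (F (- of_real x))"
  proof (rule norm_square_le_of_zeros[OF _ _ g(2)])
    show "F holomorphic_on UNIV" unfolding F_def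
      by (rule holomorphic_on_compose_gen[OF _ completed_L_holomorphic, unfolded o_def]) (auto intro!: holomorphic_intros)
    show "norm (F z) \<le> max C 0 * exp (2 powr a * norm z powr a)" if z: "norm z \<ge> max 0 R + (real m + 1)" for z
    proof -
      have n: "norm (of_nat (m + 1) :: complex) = real m + 1" by (simp only: norm_of_nat)
      have 1: "norm (of_nat (m + 1) + z) \<ge> R"
        using z n norm_diff_ineq[of z "of_nat (m + 1)"] by (simp only: add.commute[of z])
      have 2: "norm (of_nat (m + 1) + z) \<le> 2 * norm z"
        using z n norm_triangle_ineq[of "of_nat (m + 1)" z] by linarith
      have "norm (F z) \<le> C * exp (norm (of_nat (m + 1) + z) powr a)" unfolding F_def by (rule g(3)[OF 1])
      also have "\<dots> \<le> max C 0 * exp ((2 * norm z) powr a)"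
        using 2 g(1) by (intro mult_mono) (auto intro!: powr_mono2)
      finally show ?thesis by (simp add: powr_mult)
    qed
    show "norm (\<rho>\<^sup>2) \<le> norm (\<rho>\<^sup>2 - (of_real x)\<^sup>2)" if "F \<rho> = 0" for \<rho>
    proof (rule power2_le_imp_le)
      have "\<bar>Re \<rho>\<bar> \<le> 1 / 2"
        using completed_L_zero_Re[of "of_nat (m + 1) + \<rho>"] that by (simp add: F_def)
      hence "(Re \<rho>)\<^sup>2 \<le> (1 / 2)\<^sup>2" by (subst abs_le_square_iff[symmetric]) simp
      hence "x\<^sup>2 - 2 * (Re \<rho>)\<^sup>2 + 2 * (Im \<rho>)\<^sup>2 \<ge> 0" using x by (simp add: power2_eq_square)
      hence "x\<^sup>2 * (x\<^sup>2 - 2 * (Re \<rho>)\<^sup>2 + 2 * (Im \<rho>)\<^sup>2) \<ge> 0" by simp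
      also have "x\<^sup>2 * (x\<^sup>2 - 2 * (Re \<rho>)\<^sup>2 + 2 * (Im \<rho>)\<^sup>2) = (norm (\<rho>\<^sup>2 - (of_real x)\<^sup>2))\<^sup>2 - (norm (\<rho>\<^sup>2))\<^sup>2"
        unfolding cmod_power2 by (simp add: power2_eq_square algebra_simps)
      finally show "(norm (\<rho>\<^sup>2))\<^sup>2 \<le> (norm (\<rho>\<^sup>2 - (of_real x)\<^sup>2))\<^sup>2" by simp
    qed auto
  qed
  also have "norm (F (- of_real x)) = norm (F (of_real x))"
  proof -
    obtain \<epsilon> where \<epsilon>: "\<epsilon> \<in> {1, -1}" "\<And>s. completed_L M s = \<epsilon> * completed_L M (of_nat (weight M) + 1 - s)"
      using functional_equation by blast
    have "F (- of_real x) = \<epsilon> * F (of_real x)"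
      unfolding F_def by (subst \<epsilon>(2)) (simp add: weight_def algebra_simps)
    thus ?thesis using \<epsilon>(1) by (auto simp: norm_mult)
  qed
  finally have "norm (F 0) \<le> norm (F (of_real x))" by (simp flip: power2_eq_square)
  moreover have "F 0 = of_real (Lambda (real m + 1))" unfolding F_def using Lambda_center_nonneg(1) by simp
  moreover have "F (of_real x) = of_real (Lambda (real m + 1 + x))"
    unfolding F_def using completed_L_of_real(1)[of "real m + 1 + x"] x2 by (simp add: add_ac)
  ultimately show ?thesis using Lambda_center_nonneg(2) Lambda_pos[of "real m + 1 + x"] x2 by simp
qed

end

section \<open>The coefficients of the period polynomial\<close>

lemma binomial_Suc_real:
  assumes "k \<le> n"
  shows "real (n choose Suc k) * real (Suc k) = real (n choose k) * (real n - real k)"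
proof -
  have "Suc k * (n choose Suc k) = (n - k) * (n choose k)"
    using binomial_absorption[of k n] binomial_absorb_comp[of n k] by simp
  hence "real (Suc k) * real (n choose Suc k) = real (n - k) * real (n choose k)"
    by (simp only: of_nat_mult[symmetric])
  thus ?thesis using assms by (simp add: of_nat_diff mult.commute)
qed

lemma A_const_ge:
  assumes "1 \<le> j" "j < m"
  shows "2 * pi / (real m - real j) * (zeta_real (real j + 1/2) / zeta_real (real j + 3/2))\<^sup>2 \<le> A_const m"
  unfolding A_const_def using assms by (intro Max_ge) auto

lemma A_const_nonneg:
  assumes "m \<ge> 2"
  shows "A_const m \<ge> 0"
proof -
  have "0 \<le> 2 * pi / (real m - real 1) * (zeta_real (real 1 + 1/2) / zeta_real (real 1 + 3/2))\<^sup>2"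
    using assms by simp
  also have "\<dots> \<le> A_const m" using assms by (intro A_const_ge) auto
  finally show ?thesis .
qed

context automorphic
begin

definition binom_weight :: "nat \<Rightarrow> real" where
  "binom_weight k = (\<Prod>\<nu>=0..m. real ((2 * m - \<nu>) choose k) ^ hodge M \<nu>)"

definition trig_coeff :: "nat \<Rightarrow> real" where
  "trig_coeff j = binom_weight (m - j) * Lambda (real m + 1 + real j) / (if j = 0 then 2 else 1)"

definition hodge_sum :: nat where
  "hodge_sum = (\<Sum>\<nu>=0..m. hodge M \<nu>)"

lemma rank_hodge_sum: "rank M = 2 * hodge_sum"
  using rank_eq by (simp add: hodge_sum_def)

lemma period_poly_eq:
  assumes \<epsilon>: "\<epsilon> \<in> {1, -1}" "\<And>s. completed_L M s = \<epsilon> * completed_L M (of_nat (weight M) + 1 - s)"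
  shows "period_poly M =
    (\<Sum>j\<le>m. monom (of_real (trig_coeff j)) (m - j) + monom (\<epsilon> * of_real (trig_coeff j)) (m + j))"
proof (rule poly_eqI)
  fix n
  define c where "c n = (\<Prod>\<nu>=0..m. of_nat ((2 * m - \<nu>) choose nat (int m - \<bar>int m - int n\<bar>)) ^ hodge M \<nu>)
      * completed_L M (of_nat (2 * m + 1 - n))" for n
  have bw: "(\<Prod>\<nu>=0..m. (of_nat ((2 * m - \<nu>) choose k) :: complex) ^ hodge M \<nu>) = of_real (binom_weight k)" for k
    by (simp add: binom_weight_def)
  have "coeff (period_poly M) n = (\<Sum>j=0..2*m. if j = n then c j else 0)"
    unfolding period_poly_def Let_def coeff_sum coeff_monom c_def ..
  hence lhs: "coeff (period_poly M) n = (if n \<le> 2 * m then c n else 0)" by simp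
  have "coeff (\<Sum>j\<le>m. monom (of_real (trig_coeff j)) (m - j) + monom (\<epsilon> * of_real (trig_coeff j)) (m + j)) n
      = (\<Sum>j\<le>m. if j = m - n then (if n \<le> m then of_real (trig_coeff j) else 0) else 0) +
        (\<Sum>j\<le>m. if j = n - m then (if m \<le> n then \<epsilon> * of_real (trig_coeff j) else 0) else 0)"
    unfolding coeff_sum coeff_add coeff_monom sum.distrib
    by (intro arg_cong2[of _ _ _ _ "(+)"] sum.cong) auto
  hence rhs: "coeff (\<Sum>j\<le>m. monom (of_real (trig_coeff j)) (m - j) + monom (\<epsilon> * of_real (trig_coeff j)) (m + j)) n
      = (if n \<le> m then of_real (trig_coeff (m - n)) else 0) +
        (if m \<le> n \<and> n \<le> 2 * m then \<epsilon> * of_real (trig_coeff (n - m)) else 0)"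
    by auto
  have Lam: "completed_L M (of_nat (m + 1 + j)) = of_real (Lambda (real m + 1 + real j))" for j
  proof (cases "j = 0")
    case False
    thus ?thesis using completed_L_of_real(1)[of "real m + 1 + real j"] by (simp add: add_ac)
  qed (use Lambda_center_nonneg(1) in simp)
  consider "n < m" | "n = m" | "m < n" "n \<le> 2 * m" | "n > 2 * m" by linarith
  thus "coeff (period_poly M) n =
      coeff (\<Sum>j\<le>m. monom (of_real (trig_coeff j)) (m - j) + monom (\<epsilon> * of_real (trig_coeff j)) (m + j)) n"
  proof cases
    case 1
    hence "nat (int m - \<bar>int m - int n\<bar>) = n" "2 * m + 1 - n = m + 1 + (m - n)" by auto
    hence "c n = of_real (binom_weight n * Lambda (real m + 1 + real (m - n)))"
      unfolding c_def bw by (simp only: Lam of_real_mult)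
    thus ?thesis unfolding lhs rhs using 1 by (simp add: trig_coeff_def)
  next
    case 2
    have "c m = of_real (binom_weight m * Lambda (real m + 1))"
      unfolding c_def bw using Lam[of 0] by simp
    moreover have "(1 + \<epsilon>) * completed_L M (of_nat (m + 1)) = 2 * completed_L M (of_nat (m + 1))"
    proof -
      have "of_nat (weight M) + 1 - of_nat (m + 1) = (of_nat (m + 1) :: complex)" by (simp add: weight_def)
      hence "completed_L M (of_nat (m + 1)) = \<epsilon> * completed_L M (of_nat (m + 1))" using \<epsilon>(2) by metis
      thus ?thesis by (simp add: algebra_simps)
    qed
    hence "(1 + \<epsilon>) * of_real (Lambda (real m + 1)) = (2 * of_real (Lambda (real m + 1)) :: complex)"
      unfolding Lambda_center_nonneg(1) .
    hence "of_real (trig_coeff 0) + \<epsilon> * of_real (trig_coeff 0) = (of_real (binom_weight m * Lambda (real m + 1)) :: complex)"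
      by (simp add: trig_coeff_def field_simps)
    ultimately show ?thesis unfolding lhs rhs using 2 by simp
  next
    case 3
    hence e: "nat (int m - \<bar>int m - int n\<bar>) = m - (n - m)" by auto
    have "of_nat (weight M) + 1 - of_nat (2 * m + 1 - n) = (of_nat (m + 1 + (n - m)) :: complex)"
      using 3 by (simp add: weight_def of_nat_diff)
    hence "completed_L M (of_nat (2 * m + 1 - n)) = \<epsilon> * of_real (Lambda (real m + 1 + real (n - m)))"
      using \<epsilon>(2) Lam[of "n - m"] by metis
    hence "c n = \<epsilon> * of_real (binom_weight (m - (n - m)) * Lambda (real m + 1 + real (n - m)))"
      unfolding c_def bw e by simp
    thus ?thesis unfolding lhs rhs using 3 by (simp add: trig_coeff_def)
  next
    case 4
    thus ?thesis unfolding lhs rhs by simp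
  qed
qed

lemma binom_weight_pos:
  assumes "k \<le> m"
  shows "binom_weight k > 0"
  unfolding binom_weight_def using assms by (intro prod_pos ballI zero_less_power) auto

text \<open>The binomial weights are chosen such that the quotient depends on the sum of the Hodge numbers only.\<close>

lemma binom_weight_L_inf_real:
  assumes "j < m"
  shows "binom_weight (m - j) * L_inf_real (real m + 1 + real j) =
    binom_weight (m - Suc j) * L_inf_real (real m + 1 + real (Suc j)) * (2 * pi / (real m - real j)) ^ hodge_sum"
proof -
  have "real ((2 * m - \<nu>) choose (m - j)) * Gamma_C_real (real m + 1 + real j - real \<nu>) =
    real ((2 * m - \<nu>) choose (m - Suc j)) * Gamma_C_real (real m + 1 + real (Suc j) - real \<nu>) * (2 * pi / (real m - real j))"
    if "\<nu> \<le> m" for \<nu>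
  proof -
    define g where "g = real m + 1 + real j - real \<nu>"
    have g: "g > 0" using that by (simp add: g_def)
    have mj: "real m - real j > 0" using assms by simp
    have S: "Suc (m - Suc j) = m - j" using assms by simp
    have "real ((2 * m - \<nu>) choose (m - j)) * real (m - j) = real ((2 * m - \<nu>) choose (m - Suc j)) * (real (2 * m - \<nu>) - real (m - Suc j))"
      using binomial_Suc_real[of "m - Suc j" "2 * m - \<nu>"] that unfolding S by simp
    also have "real (2 * m - \<nu>) - real (m - Suc j) = g" using that assms by (simp add: g_def of_nat_diff)
    also have "real (m - j) = real m - real j" using assms by simp
    finally have "real ((2 * m - \<nu>) choose (m - j)) = real ((2 * m - \<nu>) choose (m - Suc j)) * g / (real m - real j)"
      using mj by (simp add: field_simps)
    moreover have "Gamma_C_real (real m + 1 + real (Suc j) - real \<nu>) = g / (2 * pi) * Gamma_C_real g"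
      using Gamma_C_real_plus_1[OF g] by (simp add: g_def algebra_simps)
    ultimately show ?thesis using g mj by (simp add: g_def[symmetric])
  qed
  hence "(\<Prod>\<nu>=0..m. (real ((2 * m - \<nu>) choose (m - j)) * Gamma_C_real (real m + 1 + real j - real \<nu>)) ^ hodge M \<nu>) =
    (\<Prod>\<nu>=0..m. (real ((2 * m - \<nu>) choose (m - Suc j)) * Gamma_C_real (real m + 1 + real (Suc j) - real \<nu>) * (2 * pi / (real m - real j))) ^ hodge M \<nu>)"
    by (intro prod.cong) auto
  thus ?thesis
    unfolding binom_weight_def L_inf_real_def hodge_sum_def power_mult_distrib prod.distrib power_sum .
qed

lemma L_real_le_shift:
  assumes "x > real m + 3 / 2" "t \<ge> 0"
  shows "L_real x \<le> (zeta_real (x - (real m + 1 / 2)) / zeta_real (x - (real m + 1 / 2) + t)) ^ rank M * L_real (x + t)"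
proof -
  have "norm (motive_L M (of_real x)) \<le> (zeta_real (x - (real m + 1 / 2)) / zeta_real (x - (real m + 1 / 2) + t)) ^ rank M
      * norm (motive_L M (of_real (x + t)))"
    using norm_motive_L_le_shift[of "of_real x" t] assms unfolding weight_half by simp
  moreover have "motive_L M (of_real x) = of_real (L_real x)" "motive_L M (of_real (x + t)) = of_real (L_real (x + t))"
    using assms by (auto intro!: motive_L_of_real simp del: of_real_add)
  ultimately show ?thesis using L_real_pos[of x] L_real_pos[of "x + t"] assms by (simp del: of_real_add)
qed

lemma trig_coeff_step:
  assumes j: "1 \<le> j" "j < m"
    and B: "2 * pi / (real m - real j) * (zeta_real (real j + 1/2) / zeta_real (real j + 3/2))\<^sup>2 \<le> B"
  shows "trig_coeff j \<le> B ^ hodge_sum / sqrt (conductor M) * trig_coeff (Suc j)"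
proof -
  define x where "x = real m + 1 + real j"
  define N where "N = real (conductor M)"
  define q where "q = zeta_real (real j + 1/2) / zeta_real (real j + 3/2)"
  define p where "p = 2 * pi / (real m - real j)"
  have N: "N > 0" using conductor_ge_1 by (simp add: N_def)
  have x: "x > real m + 3 / 2" "x + 1 > real m + 3 / 2" using j by (auto simp: x_def)
  have x1: "real m + 1 + real (Suc j) = x + 1" by (simp add: x_def)
  have Npow: "N powr (x / 2) = N powr ((x + 1) / 2) / sqrt N"
    using N powr_diff[of N "(x + 1) / 2" "1 / 2"] by (simp add: powr_half_sqrt add_divide_distrib)
  have L: "L_real x \<le> q ^ rank M * L_real (x + 1)"
    using L_real_le_shift[OF x(1), of 1] by (simp add: x_def q_def add_ac)
  have "trig_coeff j = binom_weight (m - j) * L_inf_real x * (N powr (x / 2) * L_real x)"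
    using j completed_L_of_real(2)[OF x(1)] by (simp add: trig_coeff_def x_def[symmetric] N_def)
  also have "\<dots> = binom_weight (m - Suc j) * L_inf_real (x + 1) * p ^ hodge_sum * (N powr (x / 2) * L_real x)"
    using binom_weight_L_inf_real[OF j(2)] unfolding x1 x_def[symmetric] p_def by simp
  also have "\<dots> \<le> binom_weight (m - Suc j) * L_inf_real (x + 1) * p ^ hodge_sum * (N powr (x / 2) * (q ^ rank M * L_real (x + 1)))"
    using L binom_weight_pos[of "m - Suc j"] L_inf_real_pos[of "x + 1"] x j
    by (intro mult_left_mono mult_nonneg_nonneg) (auto simp: p_def)
  also have "\<dots> = (p * q\<^sup>2) ^ hodge_sum / sqrt N * (binom_weight (m - Suc j) * (N powr ((x + 1) / 2) * L_inf_real (x + 1) * L_real (x + 1)))"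
    unfolding Npow rank_hodge_sum by (simp add: power_mult_distrib power_mult)
  also have "binom_weight (m - Suc j) * (N powr ((x + 1) / 2) * L_inf_real (x + 1) * L_real (x + 1)) = trig_coeff (Suc j)"
    using completed_L_of_real(2)[OF x(2)] unfolding trig_coeff_def x1 N_def by simp
  also have "(p * q\<^sup>2) ^ hodge_sum / sqrt N * trig_coeff (Suc j) \<le> B ^ hodge_sum / sqrt N * trig_coeff (Suc j)"
  proof (intro mult_right_mono divide_right_mono power_mono)
    show "p * q\<^sup>2 \<le> B" using B by (simp add: p_def q_def)
    show "0 \<le> p * q\<^sup>2" using j by (simp add: p_def)
    show "0 \<le> trig_coeff (Suc j)" unfolding trig_coeff_def x1
      using Lambda_pos[OF x(2)] binom_weight_pos[of "m - Suc j"] by simp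
  qed (use N in simp)
  finally show ?thesis by (simp add: N_def)
qed

lemma binom_weight_center_le:
  assumes m: "m \<ge> 1" and hyp: "2 * real m ^ hodge M m \<ge> (1 + 1 / real m) ^ hodge M 0"
  shows "binom_weight m \<le> 2 * binom_weight (m - 1)"
proof -
  define t where "t \<nu> = (if \<nu> = 0 then 1 + 1 / real m else if \<nu> = m then 1 / real m else 1)" for \<nu>
  have m0: "real m > 0" using m by simp
  have "binom_weight m \<le> (\<Prod>\<nu>=0..m. (real ((2 * m - \<nu>) choose (m - 1)) * t \<nu>) ^ hodge M \<nu>)"
    unfolding binom_weight_def
  proof (intro prod_mono conjI power_mono)
    fix \<nu> assume "\<nu> \<in> {0..m}"
    hence \<nu>: "\<nu> \<le> m" by simp
    have "real ((2 * m - \<nu>) choose m) * real m = real ((2 * m - \<nu>) choose (m - 1)) * (real (2 * m - \<nu>) - real (m - 1))"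
      using binomial_Suc_real[of "m - 1" "2 * m - \<nu>"] \<nu> m by simp
    also have "real (2 * m - \<nu>) - real (m - 1) = real m + 1 - real \<nu>" using \<nu> m by (simp add: of_nat_diff)
    finally have "real ((2 * m - \<nu>) choose m) = real ((2 * m - \<nu>) choose (m - 1)) * ((real m + 1 - real \<nu>) / real m)"
      using m0 by (simp add: field_simps)
    also have "\<dots> \<le> real ((2 * m - \<nu>) choose (m - 1)) * t \<nu>"
      using m0 \<nu> by (intro mult_left_mono) (auto simp: t_def field_simps)
    finally show "real ((2 * m - \<nu>) choose m) \<le> real ((2 * m - \<nu>) choose (m - 1)) * t \<nu>" .
  qed auto
  also have "\<dots> = binom_weight (m - 1) * (\<Prod>\<nu>=0..m. t \<nu> ^ hodge M \<nu>)"
    unfolding power_mult_distrib prod.distrib binom_weight_def ..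
  also have "(\<Prod>\<nu>=0..m. t \<nu> ^ hodge M \<nu>) = (\<Prod>\<nu>\<in>{0, m}. t \<nu> ^ hodge M \<nu>)"
    using m by (intro prod.mono_neutral_right) (auto simp: t_def)
  also have "\<dots> = (1 + 1 / real m) ^ hodge M 0 / real m ^ hodge M m"
    using m by (simp add: t_def power_one_over)
  also have "\<dots> \<le> 2" using hyp m0 by (simp add: divide_le_eq)
  finally show ?thesis using binom_weight_pos[of "m - 1"] by (simp add: mult.commute)
qed

lemma trig_coeff_pos:
  assumes "1 \<le> j"
  shows "trig_coeff j > 0"
  using assms Lambda_pos[of "real m + 1 + real j"] binom_weight_pos[of "m - j"] by (simp add: trig_coeff_def)

lemma trig_coeff_0_le_1:
  assumes m: "m \<ge> 1" and hyp: "2 * real m ^ hodge M m \<ge> (1 + 1 / real m) ^ hodge M 0"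
  shows "trig_coeff 0 \<le> trig_coeff 1"
proof -
  have "trig_coeff 0 = binom_weight m / 2 * Lambda (real m + 1)" by (simp add: trig_coeff_def)
  also have "\<dots> \<le> binom_weight (m - 1) * Lambda (real m + 1 + 1)"
    using binom_weight_center_le[OF assms] Lambda_center_le[of 1] Lambda_center_nonneg(2) binom_weight_pos[of "m - 1"]
    by (intro mult_mono) auto
  finally show ?thesis by (simp add: trig_coeff_def)
qed

lemma trig_coeff_mono:
  assumes m: "m \<ge> 1" and hyp: "2 * real m ^ hodge M m \<ge> (1 + 1 / real m) ^ hodge M 0"
    and N: "m \<ge> 2 \<Longrightarrow> real (conductor M) > A_const m ^ rank M" and "i < m"
  shows "trig_coeff i \<le> trig_coeff (Suc i)"
proof (cases "i = 0")
  case True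
  thus ?thesis using trig_coeff_0_le_1[OF m hyp] by simp
next
  case False
  hence i: "1 \<le> i" "m \<ge> 2" using \<open>i < m\<close> by auto
  have "A_const m ^ hodge_sum = sqrt (A_const m ^ rank M)"
    using A_const_nonneg[OF i(2)] by (simp add: rank_hodge_sum power_even_eq real_sqrt_abs)
  also have "\<dots> \<le> sqrt (conductor M)" using N[OF i(2)] by simp
  finally have "A_const m ^ hodge_sum / sqrt (conductor M) \<le> 1"
    using conductor_ge_1 by (simp add: divide_le_eq)
  have "trig_coeff i \<le> A_const m ^ hodge_sum / sqrt (conductor M) * trig_coeff (Suc i)"
    using i \<open>i < m\<close> by (intro trig_coeff_step A_const_ge) auto
  also have "\<dots> \<le> 1 * trig_coeff (Suc i)"
    using trig_coeff_pos[of "Suc i"] \<open>_ \<le> 1\<close> by (intro mult_right_mono) auto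
  finally show ?thesis by simp
qed

lemma self_inversive_period_poly:
  assumes m: "m \<ge> 1" and hyp: "2 * real m ^ hodge M m \<ge> (1 + 1 / real m) ^ hodge M 0"
    and N: "m \<ge> 2 \<Longrightarrow> real (conductor M) > A_const m ^ rank M"
  shows "\<exists>\<epsilon>. self_inversive m trig_coeff \<epsilon> (period_poly M)"
proof -
  obtain \<epsilon> where \<epsilon>: "\<epsilon> \<in> {1, -1}" "\<And>s. completed_L M s = \<epsilon> * completed_L M (of_nat (weight M) + 1 - s)"
    using functional_equation by blast
  have "self_inversive m trig_coeff \<epsilon> (period_poly M)"
  proof
    show "0 \<le> trig_coeff 0"
      using Lambda_center_nonneg(2) binom_weight_pos[of m] by (simp add: trig_coeff_def)
    show "trig_coeff i \<le> trig_coeff (Suc i)" if "i < m" for i by (rule trig_coeff_mono[OF assms that])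
  qed (use m trig_coeff_pos[of m] \<epsilon> period_poly_eq[OF \<epsilon>] in auto)
  thus ?thesis ..
qed

lemma trig_coeff_small:
  assumes m: "m \<ge> 2" and hyp: "2 * real m ^ hodge M m \<ge> (1 + 1 / real m) ^ hodge M 0"
    and N: "real (conductor M) > A_const m ^ rank M" and "j < m"
  shows "trig_coeff j \<le> A_const m ^ hodge_sum / sqrt (conductor M) * trig_coeff m"
proof -
  have "trig_coeff j \<le> trig_coeff (m - 1)"
  proof (rule inc_induct[of j "m - 1"])
    fix n assume "n < m - 1" "trig_coeff (Suc n) \<le> trig_coeff (m - 1)"
    moreover have "trig_coeff n \<le> trig_coeff (Suc n)"
      using \<open>n < m - 1\<close> m N by (intro trig_coeff_mono[OF _ hyp]) auto
    ultimately show "trig_coeff n \<le> trig_coeff (m - 1)" by simp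
  qed (use \<open>j < m\<close> in auto)
  also have "\<dots> \<le> A_const m ^ hodge_sum / sqrt (conductor M) * trig_coeff (Suc (m - 1))"
    using m by (intro trig_coeff_step A_const_ge) auto
  finally show ?thesis using m by simp
qed

text \<open>
  Comparing with \<open>3/4\<close> instead of \<open>1\<close> stays inside the region of absolute convergence and saves
  a power of the conductor.
\<close>

lemma trig_coeff_small_weight_3:
  assumes m: "m = 1" and hyp: "hodge M 0 \<in> {0, 1}"
  shows "trig_coeff 0 \<le> (\<Sum>\<nu>=0..1. Gamma_C_real (11/4 - real \<nu>) / Gamma_C_real (3 - real \<nu>)) ^ (rank M div 2) *
    (zeta_real (5/4) / zeta_real (3/2)) ^ rank M * real (conductor M) powr (- (1/8)) * trig_coeff 1"
proof -
  define B where "B = (\<Sum>\<nu>=0..1. Gamma_C_real (11/4 - real \<nu>) / Gamma_C_real (3 - real \<nu>))"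
  define q where "q = zeta_real (5/4) / zeta_real (3/2)"
  define N where "N = real (conductor M)"
  have pos: "Gamma_C_real (11/4 - real \<nu>) > 0" "Gamma_C_real (3 - real \<nu>) > 0" if "\<nu> \<le> 1" for \<nu>
    using that by (auto intro!: Gamma_C_real_pos)
  have le: "Gamma_C_real (11/4 - real \<nu>) \<le> B * Gamma_C_real (3 - real \<nu>)" if "\<nu> \<le> 1" for \<nu>
  proof -
    have "Gamma_C_real (11/4 - real \<nu>) / Gamma_C_real (3 - real \<nu>) \<le> B"
      unfolding B_def using that pos by (intro member_le_sum) (auto intro!: divide_nonneg_nonneg less_imp_le)
    thus ?thesis using pos(2)[OF that] by (simp add: divide_le_eq)
  qed
  have B0: "B \<ge> 0" unfolding B_def using pos by (intro sum_nonneg divide_nonneg_nonneg) (auto intro: less_imp_le)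
  have "L_inf_real (11/4) \<le> (\<Prod>\<nu>=0..1. (B * Gamma_C_real (3 - real \<nu>)) ^ hodge M \<nu>)"
    unfolding L_inf_real_def m using le pos(1) by (intro prod_mono conjI power_mono zero_le_power) (auto intro: less_imp_le)
  also have "\<dots> = B ^ hodge_sum * L_inf_real 3"
    unfolding L_inf_real_def hodge_sum_def m power_mult_distrib prod.distrib power_sum ..
  finally have Linf: "L_inf_real (11/4) \<le> B ^ hodge_sum * L_inf_real 3" .
  have L: "L_real (11/4) \<le> q ^ rank M * L_real 3"
    using L_real_le_shift[of "11/4" "1/4"] by (simp add: m q_def)
  have Npow: "N powr (11/8) = N powr (- (1/8)) * N powr (3/2)" by (simp add: powr_add[symmetric])
  have "binom_weight 1 \<le> 2"
    using hyp by (auto simp: binom_weight_def m)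
  moreover have "Lambda 2 \<ge> 0" using Lambda_center_nonneg(2) by (simp add: m)
  ultimately have "trig_coeff 0 \<le> Lambda 2"
    using mult_right_mono[of "binom_weight 1" 2 "Lambda 2"] by (simp add: trig_coeff_def m)
  also have "\<dots> \<le> Lambda (11/4)" using Lambda_center_le[of "3/4"] by (simp add: m power2_eq_square)
  also have "\<dots> = N powr (11/8) * L_inf_real (11/4) * L_real (11/4)"
    using completed_L_of_real(2)[of "11/4"] by (simp add: m N_def)
  also have "\<dots> \<le> N powr (11/8) * (B ^ hodge_sum * L_inf_real 3) * (q ^ rank M * L_real 3)"
    using Linf L L_inf_real_pos[of "11/4"] L_real_pos[of "11/4"] L_inf_real_pos[of 3] B0
    by (intro mult_mono mult_left_mono mult_nonneg_nonneg zero_le_power) (auto simp: m)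
  also have "\<dots> = B ^ hodge_sum * q ^ rank M * N powr (- (1/8)) * (N powr (3/2) * L_inf_real 3 * L_real 3)"
    unfolding Npow by simp
  also have "N powr (3/2) * L_inf_real 3 * L_real 3 = trig_coeff 1"
    using completed_L_of_real(2)[of 3] by (simp add: trig_coeff_def m N_def binom_weight_def)
  finally show ?thesis by (simp add: B_def q_def N_def rank_hodge_sum)
qed

end

theorem theorem1p1:
  shows
    "(let hyp = (\<lambda>M. automorphic_motive M \<and> half_wt M = 1 \<and> hodge M 0 \<in> {0, 1}) in
        (\<forall>M. hyp M \<longrightarrow> zeros_on_unit_circle (period_poly M)) \<and>
        (\<forall>(d :: nat) Ms.
           (\<forall>k. hyp (Ms k) \<and> rank (Ms k) = d) \<and>
           filterlim (\<lambda>k. conductor (Ms k)) at_top sequentially \<longrightarrow>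
           zeros_tend_to_equidistributed 2 (\<lambda>k. period_poly (Ms k)))) \<and>
     (\<forall>m\<ge>2.
        let hyp = (\<lambda>M. automorphic_motive M \<and> half_wt M = m \<and>
                       2 * real m ^ hodge M m \<ge> (1 + 1 / real m) ^ hodge M 0 \<and>
                       real (conductor M) > A_const m ^ rank M) in
        (\<forall>M. hyp M \<longrightarrow> zeros_on_unit_circle (period_poly M)) \<and>
        (\<forall>(d :: nat) Ms.
           (\<forall>k. hyp (Ms k) \<and> rank (Ms k) = d) \<and>
           filterlim (\<lambda>k. conductor (Ms k)) at_top sequentially \<longrightarrow>
           zeros_tend_to_equidistributed (2 * m) (\<lambda>k. period_poly (Ms k))))"
proof -
  have si: "\<exists>\<epsilon>. self_inversive (half_wt M) (automorphic.trig_coeff M) \<epsilon> (period_poly M)"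
    if "automorphic_motive M" "half_wt M \<ge> 1"
      "2 * real (half_wt M) ^ hodge M (half_wt M) \<ge> (1 + 1 / real (half_wt M)) ^ hodge M 0"
      "half_wt M \<ge> 2 \<Longrightarrow> real (conductor M) > A_const (half_wt M) ^ rank M" for M
    using automorphic.self_inversive_period_poly[of M] that by (auto simp: automorphic_def)
  have conv: "filterlim (\<lambda>k. real (conductor (Ms k))) at_top sequentially"
    if "filterlim (\<lambda>k. conductor (Ms k)) at_top sequentially" for Ms
    using filterlim_compose[OF filterlim_real_sequentially that] .
  have weight_3: "zeros_tend_to_equidistributed 2 (\<lambda>k. period_poly (Ms k))"
    if Ms: "\<And>k. automorphic_motive (Ms k)" "\<And>k. half_wt (Ms k) = 1" "\<And>k. hodge (Ms k) 0 \<in> {0, 1}" "\<And>k. rank (Ms k) = d"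
      and N: "filterlim (\<lambda>k. conductor (Ms k)) at_top sequentially" for Ms d
  proof -
    have "\<exists>\<epsilon>. self_inversive 1 (automorphic.trig_coeff (Ms k)) \<epsilon> (period_poly (Ms k))" for k
      using si[of "Ms k"] Ms(1,2)[of k] Ms(3)[of k] by auto
    then obtain \<epsilon> where \<epsilon>: "\<And>k. self_inversive 1 (automorphic.trig_coeff (Ms k)) (\<epsilon> k) (period_poly (Ms k))"
      by metis
    define K where "K = (\<Sum>\<nu>=0..1. Gamma_C_real (11/4 - real \<nu>) / Gamma_C_real (3 - real \<nu>)) ^ (d div 2) *
      (zeta_real (5/4) / zeta_real (3/2)) ^ d"
    have "zeros_tend_to_equidistributed (2 * 1) (\<lambda>k. period_poly (Ms k))"
    proof (rule zeros_tend_to_equidistributed_self_inversive[OF \<epsilon>])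
      show "automorphic.trig_coeff (Ms k) j \<le> K * real (conductor (Ms k)) powr (- (1/8)) * automorphic.trig_coeff (Ms k) 1"
        if "j < 1" for k j
        using automorphic.trig_coeff_small_weight_3[of "Ms k"] Ms that
        unfolding K_def by (simp add: automorphic_def)
      have "(\<lambda>k. real (conductor (Ms k)) powr (- (1/8))) \<longlonglongrightarrow> 0"
        by (rule tendsto_neg_powr[OF _ conv[OF N]]) simp
      thus "(\<lambda>k. K * real (conductor (Ms k)) powr (- (1/8))) \<longlonglongrightarrow> 0" by (rule tendsto_mult_right_zero)
    qed
    thus ?thesis by simp
  qed
  have higher_weight: "zeros_tend_to_equidistributed (2 * m) (\<lambda>k. period_poly (Ms k))"
    if m: "m \<ge> 2" and Ms: "\<And>k. automorphic_motive (Ms k)" "\<And>k. half_wt (Ms k) = m"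
        "\<And>k. 2 * real m ^ hodge (Ms k) m \<ge> (1 + 1 / real m) ^ hodge (Ms k) 0"
        "\<And>k. real (conductor (Ms k)) > A_const m ^ rank (Ms k)" "\<And>k. rank (Ms k) = d"
      and N: "filterlim (\<lambda>k. conductor (Ms k)) at_top sequentially" for m Ms d
  proof -
    have "\<exists>\<epsilon>. self_inversive m (automorphic.trig_coeff (Ms k)) \<epsilon> (period_poly (Ms k))" for k
      using si[of "Ms k"] Ms(1-4)[of k] m by simp
    then obtain \<epsilon> where \<epsilon>: "\<And>k. self_inversive m (automorphic.trig_coeff (Ms k)) (\<epsilon> k) (period_poly (Ms k))"
      by metis
    show ?thesis
    proof (rule zeros_tend_to_equidistributed_self_inversive[OF \<epsilon>])
      show "automorphic.trig_coeff (Ms k) j \<le> A_const m ^ (d div 2) / sqrt (conductor (Ms k)) * automorphic.trig_coeff (Ms k) m"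
        if "j < m" for k j
        using automorphic.trig_coeff_small[of "Ms k" j] automorphic.rank_hodge_sum[of "Ms k"] Ms[of k] m that
        by (simp add: automorphic_def)
      show "(\<lambda>k. A_const m ^ (d div 2) / sqrt (conductor (Ms k))) \<longlonglongrightarrow> 0"
        by (intro real_tendsto_divide_at_top[OF tendsto_const] filterlim_compose[OF sqrt_at_top conv[OF N]])
    qed
  qed
  show ?thesis
    unfolding Let_def
  proof (intro conjI allI impI; (elim conjE)?)
    fix M assume "automorphic_motive M" "half_wt M = 1" "hodge M 0 \<in> {0, 1}"
    thus "zeros_on_unit_circle (period_poly M)"
      using si[of M] self_inversive.zeros_on_unit_circle by auto
  next
    fix d :: nat and Ms
    assume "\<forall>k. (automorphic_motive (Ms k) \<and> half_wt (Ms k) = 1 \<and> hodge (Ms k) 0 \<in> {0, 1}) \<and> rank (Ms k) = d"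
      and "filterlim (\<lambda>k. conductor (Ms k)) at_top sequentially"
    thus "zeros_tend_to_equidistributed 2 (\<lambda>k. period_poly (Ms k))" by (intro weight_3[of Ms d]) auto
  next
    fix m :: nat and M
    assume "m \<ge> 2" "automorphic_motive M" "half_wt M = m"
      "2 * real m ^ hodge M m \<ge> (1 + 1 / real m) ^ hodge M 0" "real (conductor M) > A_const m ^ rank M"
    thus "zeros_on_unit_circle (period_poly M)"
      using si[of M] self_inversive.zeros_on_unit_circle by auto
  next
    fix m d :: nat and Ms
    assume "m \<ge> 2" and "\<forall>k. (automorphic_motive (Ms k) \<and> half_wt (Ms k) = m \<and>
        2 * real m ^ hodge (Ms k) m \<ge> (1 + 1 / real m) ^ hodge (Ms k) 0 \<and>
        real (conductor (Ms k)) > A_const m ^ rank (Ms k)) \<and> rank (Ms k) = d"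
      and "filterlim (\<lambda>k. conductor (Ms k)) at_top sequentially"
    thus "zeros_tend_to_equidistributed (2 * m) (\<lambda>k. period_poly (Ms k))"
      by (intro higher_weight[of m Ms d]) auto
  qed
qed

end
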